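(* Let $S$ be a locally compact Hausdorff space with Borel $\sigma$-algebra $\mathscr{S}$, let $\mathscr{S}_0$ be an algebra of subsets of $S$ generating $\mathscr{S}$, and let $X=(X_1,\ldots,X_n)$ be an exchangeable random element of $S^n$. Assume: (a) for every $\epsilon>0$ there exist $V\in\mathscr{S}_0$ and a compact set $K$ with $V\subset K$ and $\mathbb{P}(X_1\in V)\ge1-\epsilon$; (b) for every $\epsilon>0$ and every $V\in\mathscr{S}_0$ there exist an open set $O$ and $W\in\mathscr{S}_0$ with $V\subset O\subset W$ and $\mathbb{P}(X_1\in W\setminus V)\le\epsilon$. Then for $N>n$, $X$ is $N$-extendible if and only if \[ \sup_g \frac{|\mathbb{E}\, g(X_1,\ldots,X_n)|}{\|U^N_n g\|}=1, \] where $g$ ranges over all finite linear combinations of indicator functions $\mathbf 1_{V_1\times\cdots\times V_n}$ with $V_1,\ldots,V_n\in\mathscr{S}_0$ such that $U^N_n g$ is not identically zero, and $\|\cdot\|$ is the sup norm on $S^N$.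
   Context: A random element of $S^n$ (product $\sigma$-algebra) is exchangeable if its law is invariant under all permutations of coordinates. For $N\ge n$, $X$ is $N$-extendible if there is an exchangeable random element $(Y_1,\ldots,Y_N)$ of $S^N$ with $(Y_1,\ldots,Y_n)$ equal in distribution to $X$. With $\mathfrak S[n,N]$ the set of injections $\{1,\ldots,n\}\to\{1,\ldots,N\}$ and $(N)_n=N(N-1)\cdots(N-n+1)$, for $g:S^n\to\mathbb{R}$, $U^N_n g(x_1,\ldots,x_N)=\frac1{(N)_n}\sum_{\sigma\in\mathfrak S[n,N]}g(x_{\sigma(1)},\ldots,x_{\sigma(n)})$. *)

theory Defs
  imports "HOL-Analysis.Analysis" "HOL-Probability.Probability"
begin

text \<open>Points of S^m are represented as functions nat => 'a; only the coordinates
  0..m-1 matter (index i corresponds to coordinate i+1 of the paper).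
  S^m carries the product sigma-algebra of Borel sigma-algebras.\<close>

abbreviation prodS :: "nat \<Rightarrow> (nat \<Rightarrow> 'a::topological_space) measure" where
  "prodS m \<equiv> PiM {..<m} (\<lambda>_. borel)"

definition exchangeable :: "'b measure \<Rightarrow> nat \<Rightarrow> ('b \<Rightarrow> nat \<Rightarrow> 'a::topological_space) \<Rightarrow> bool" where
  "exchangeable M n X \<longleftrightarrow> X \<in> M \<rightarrow>\<^sub>M prodS n \<and>
     (\<forall>\<pi>. \<pi> permutes {..<n} \<longrightarrow>
        distr M (prodS n) (\<lambda>\<omega>. restrict (\<lambda>i. X \<omega> (\<pi> i)) {..<n}) = distr M (prodS n) X)"

text \<open>N-extendibility: there is an exchangeable random element Y of S^N (on some
  probability space; w.l.o.g. the canonical one on S^N) whose first n coordinates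
  have the same law as X.\<close>
definition extendible :: "'b measure \<Rightarrow> nat \<Rightarrow> ('b \<Rightarrow> nat \<Rightarrow> 'a::topological_space) \<Rightarrow> nat \<Rightarrow> bool" where
  "extendible M n X N \<longleftrightarrow> n \<le> N \<and>
     (\<exists>(Q :: (nat \<Rightarrow> 'a) measure) Y. prob_space Q \<and> exchangeable Q N Y \<and>
        distr Q (prodS n) (\<lambda>\<omega>. restrict (Y \<omega>) {..<n}) = distr M (prodS n) X)"

definition simple_rect_fun :: "'a set set \<Rightarrow> nat \<Rightarrow> ((nat \<Rightarrow> 'a) \<Rightarrow> real) set" where
  "simple_rect_fun S0 n = {g. \<exists>(m::nat) (c::nat \<Rightarrow> real) (V::nat \<Rightarrow> nat \<Rightarrow> 'a set).
      (\<forall>j<m. \<forall>i<n. V j i \<in> S0) \<and>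
      g = (\<lambda>x. \<Sum>j<m. c j * (\<Prod>i<n. indicator (V j i) (x i)))}"

definition injs :: "nat \<Rightarrow> nat \<Rightarrow> (nat \<Rightarrow> nat) set" where
  "injs n N = {\<sigma>. \<sigma> \<in> {..<n} \<rightarrow>\<^sub>E {..<N} \<and> inj_on \<sigma> {..<n}}"

definition falling :: "nat \<Rightarrow> nat \<Rightarrow> real" where
  "falling N n = (\<Prod>k<n. real (N - k))"

definition U :: "nat \<Rightarrow> nat \<Rightarrow> ((nat \<Rightarrow> 'a) \<Rightarrow> real) \<Rightarrow> (nat \<Rightarrow> 'a) \<Rightarrow> real" where
  "U N n g x = (1 / falling N n) * (\<Sum>\<sigma>\<in>injs n N. g (\<lambda>i. x (\<sigma> i)))"

definition supnorm :: "((nat \<Rightarrow> 'a) \<Rightarrow> real) \<Rightarrow> real" where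
  "supnorm h = (SUP x. \<bar>h x\<bar>)"

end

theory Submission
  imports Defs
begin

text \<open>If the law of \<open>X\<close> extends to an exchangeable \<open>Y\<close>, then \<open>E g(X) = E U g(Y)\<close>, which is bounded by the
  sup norm of \<open>U g\<close>, and \<open>g = 1\<close> attains the bound. Conversely, applying the bound to \<open>g + c\<close> with \<open>c\<close>
  large gives \<open>E g(X) \<le> sup U g\<close> for all \<open>g\<close>, including those with \<open>U g = 0\<close>. The theorem of Hahn and
  Banach, with the sublinear functional \<open>h \<mapsto> sup\<^sub>x avg\<^sub>\<pi> h(x \<circ> \<pi>)\<close>,
  turns \<open>U g \<mapsto> E g(X)\<close> into a permutation-invariant positive functional on all bounded functions,
  hence into a finitely additive exchangeable probability on all subsets of \<open>S\<^sup>N\<close> with the right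
  \<open>n\<close>-dimensional marginal. Its one-dimensional marginals are the law of \<open>X\<^sub>1\<close>; conditions (a) and (b)
  therefore give inner approximation of cylinders by closed sets and tightness, and
  compactness of products yields countable additivity.\<close>

subsection \<open>Dominated extension of linear functionals\<close>

text \<open>Homogeneity is demanded only as an inequality for positive factors, which passes easily
  to infima; using the reciprocal factor turns it into an equality. The value at 0 is not determined
  by positive factors and is fixed separately.\<close>

definition sublinear :: "('v::real_vector \<Rightarrow> real) \<Rightarrow> bool" where
  "sublinear q \<longleftrightarrow> q 0 = 0 \<and> (\<forall>x y. q (x + y) \<le> q x + q y) \<and> (\<forall>c>0. \<forall>x. q (c *\<^sub>R x) \<le> c * q x)"

lemma sublinear_0: "sublinear q \<Longrightarrow> q 0 = 0"
  and sublinear_add: "sublinear q \<Longrightarrow> q (x + y) \<le> q x + q y"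
  by (auto simp: sublinear_def)

lemma sublinear_scaleR:
  assumes "sublinear q" "c > 0"
  shows "q (c *\<^sub>R x) = c * q x"
proof (rule antisym)
  show "q (c *\<^sub>R x) \<le> c * q x"
    using assms by (simp add: sublinear_def)
  have "q ((1 / c) *\<^sub>R c *\<^sub>R x) \<le> (1 / c) * q (c *\<^sub>R x)"
    using assms unfolding sublinear_def by (meson zero_less_divide_1_iff)
  then show "c * q x \<le> q (c *\<^sub>R x)"
    using assms(2) by (simp add: field_simps)
qed

lemma sublinear_minus: "sublinear q \<Longrightarrow> - q (- x) \<le> q x"
  using sublinear_add[of q x "- x"] sublinear_0[of q] by simp

text \<open>Both the extension step and the linearity of minimal sublinear functionals are instances
  of this construction, with the graph of a functional and a single ray as the cone.\<close>

lemma sublinear_lower_cone: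
  fixes q :: "'v::real_vector \<Rightarrow> real" and D :: "('v \<times> real) set"
  assumes q: "sublinear q"
    and D0: "0 \<in> D"
    and Dadd: "\<And>z w. z \<in> D \<Longrightarrow> w \<in> D \<Longrightarrow> z + w \<in> D"
    and Dscale: "\<And>c z. c > 0 \<Longrightarrow> z \<in> D \<Longrightarrow> c *\<^sub>R z \<in> D"
    and dom: "\<And>z. z \<in> D \<Longrightarrow> snd z \<le> q (fst z)"
  obtains q' where "sublinear q'" "\<And>x. q' x \<le> q x" "\<And>z. z \<in> D \<Longrightarrow> q' (- fst z) \<le> - snd z"
proof
  \<comment> \<open>This is the largest sublinear functional below \<open>q\<close> that satisfies
    \<open>q' (- fst z) \<le> - snd z\<close> on \<open>D\<close>: any such \<open>r\<close> has
    \<open>r x \<le> r (x + fst z) + r (- fst z)\<close>.\<close>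
  define q' where "q' x = (INF z\<in>D. q (x + fst z) - snd z)" for x
  have bdd: "bdd_below ((\<lambda>z. q (x + fst z) - snd z) ` D)" for x
  proof (rule bdd_belowI2[where m = "- q (- x)"])
    fix z assume "z \<in> D"
    from dom[OF this] have "snd z \<le> q (fst z)" .
    also have "\<dots> = q (- x + (x + fst z))" by simp
    also have "\<dots> \<le> q (- x) + q (x + fst z)" by (rule sublinear_add[OF q])
    finally show "- q (- x) \<le> q (x + fst z) - snd z" by simp
  qed
  have le: "q' x \<le> q (x + fst z) - snd z" if "z \<in> D" for x z
    unfolding q'_def by (rule cINF_lower[OF bdd that])
  have ge: "m \<le> q' x" if "\<And>z. z \<in> D \<Longrightarrow> m \<le> q (x + fst z) - snd z" for m x
    unfolding q'_def using D0 that by (intro cINF_greatest) auto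
  show "q' x \<le> q x" for x
    using le[OF D0, of x] by simp
  show "q' (- fst z) \<le> - snd z" if "z \<in> D" for z
    using le[OF that, of "- fst z"] sublinear_0[OF q] by simp
  show "sublinear q'"
    unfolding sublinear_def
  proof (intro conjI allI impI)
    have "q' 0 \<le> 0"
      using le[OF D0, of 0] sublinear_0[OF q] by simp
    moreover have "0 \<le> q' 0"
      by (rule ge) (use dom in auto)
    ultimately show "q' 0 = 0" by simp
  next
    fix x y
    have "q' (x + y) - q' y \<le> q (x + fst z) - snd z" if z: "z \<in> D" for z
    proof -
      \<comment> \<open>The infimum is taken first over \<open>w\<close> with \<open>z\<close>
        fixed, then over \<open>z\<close>; closure of \<open>D\<close> under sums makes
        \<open>z + w\<close> an admissible competitor for \<open>x + y\<close>.\<close>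
      have "q' (x + y) - (q (x + fst z) - snd z) \<le> q (y + fst w) - snd w" if w: "w \<in> D" for w
      proof -
        have "q' (x + y) \<le> q (x + y + fst (z + w)) - snd (z + w)"
          by (rule le[OF Dadd[OF z w]])
        also have "q (x + y + fst (z + w)) = q ((x + fst z) + (y + fst w))"
          by (simp add: algebra_simps)
        finally show ?thesis
          using sublinear_add[OF q, of "x + fst z" "y + fst w"] by simp
      qed
      from ge[OF this] show ?thesis by simp
    qed
    from ge[OF this] show "q' (x + y) \<le> q' x + q' y" by simp
  next
    fix c :: real and x assume c: "c > 0"
    have "q' (c *\<^sub>R x) / c \<le> q (x + fst z) - snd z" if "z \<in> D" for z
    proof -
      have "q' (c *\<^sub>R x) \<le> q (c *\<^sub>R x + fst (c *\<^sub>R z)) - snd (c *\<^sub>R z)"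
        by (rule le[OF Dscale[OF c that]])
      also have "\<dots> = c * (q (x + fst z) - snd z)"
        using sublinear_scaleR[OF q c, of "x + fst z"] by (simp add: algebra_simps)
      finally show ?thesis using c by (simp add: field_simps)
    qed
    from ge[OF this] show "q' (c *\<^sub>R x) \<le> c * q' x"
      using c by (simp add: field_simps)
  qed
qed

text \<open>Lowering \<open>q\<close> along the ray through \<open>(y, q y)\<close> yields a
  sublinear functional below \<open>q\<close> whose value at \<open>- y\<close> is at most
  \<open>- q y\<close>. By minimality it is \<open>q\<close> itself, so \<open>q\<close> is odd, and
  an odd sublinear functional is linear.\<close>

lemma minimal_sublinear_linear:
  fixes q :: "'v::real_vector \<Rightarrow> real"
  assumes q: "sublinear q"
    and minimal: "\<And>q'. sublinear q' \<Longrightarrow> (\<And>x. q' x \<le> q x) \<Longrightarrow> q' = q"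
  shows "linear q"
proof -
  have minus: "q (- y) = - q y" for y
  proof -
    define D where "D = {(t *\<^sub>R y, t * q y) | t. t \<ge> 0}"
    have mem: "(t *\<^sub>R y, t * q y) \<in> D" if "t \<ge> 0" for t
      using that by (auto simp: D_def)
    have memE: thesis if "z \<in> D" "\<And>t. t \<ge> 0 \<Longrightarrow> z = (t *\<^sub>R y, t * q y) \<Longrightarrow> thesis" for z thesis
      using that by (auto simp: D_def)
    have "q (- y) \<le> - q y"
    proof (rule sublinear_lower_cone[OF q, of D])
      show "0 \<in> D" using mem[of 0] by (simp add: zero_prod_def)
      show "z + w \<in> D" if "z \<in> D" "w \<in> D" for z w
        using that mem by (elim memE) (simp flip: scaleR_left.add distrib_right)
      show "c *\<^sub>R z \<in> D" if "c > 0" "z \<in> D" for c z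
        using that mem by (elim memE) (simp flip: mult.assoc)
      show "snd z \<le> q (fst z)" if "z \<in> D" for z
        using that
      proof (rule memE)
        fix t :: real assume "t \<ge> 0" "z = (t *\<^sub>R y, t * q y)"
        then show ?thesis
          \<comment> \<open>The apex \<open>t = 0\<close> of the ray is separate, since homogeneity
            covers only positive factors.\<close>
          using sublinear_scaleR[OF q, of t y] sublinear_0[OF q] by (cases "t = 0") auto
      qed
    next
      fix q' assume q': "sublinear q'" "\<And>x. q' x \<le> q x" "\<And>z. z \<in> D \<Longrightarrow> q' (- fst z) \<le> - snd z"
      have "(y, q y) \<in> D" using mem[of 1] by simp
      from q'(3)[OF this] show "q (- y) \<le> - q y"
        using minimal[OF q'(1,2)] by simp
    qed
    then show ?thesis using sublinear_minus[OF q, of "- y"] by simp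
  qed
  show ?thesis
  proof (rule linearI)
    fix x y
    \<comment> \<open>Superadditivity: oddness turns this into
      \<open>q x \<le> q (x + y) - q y\<close>.\<close>
    have "q (x + y + - y) \<le> q (x + y) + q (- y)" by (rule sublinear_add[OF q])
    then show "q (x + y) = q x + q y"
      using sublinear_add[OF q, of x y] minus[of y] by simp
  next
    fix c :: real and x
    show "q (c *\<^sub>R x) = c *\<^sub>R q x"
    proof (cases c "0::real" rule: linorder_cases)
      case less
      then show ?thesis
        using sublinear_scaleR[OF q, of "- c" x] minus[of "c *\<^sub>R x"] by simp
    next
      case equal
      then show ?thesis using sublinear_0[OF q] by simp
    next
      case greater
      then show ?thesis using sublinear_scaleR[OF q] by simp
    qed
  qed
qed

text \<open>Zorn's lemma gives a minimal sublinear functional below \<open>p\<close>, and minimal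
  ones are linear. Pointwise infima serve as bounds of chains.\<close>

lemma linear_below_sublinear:
  fixes p :: "'v::real_vector \<Rightarrow> real"
  assumes p: "sublinear p"
  obtains F where "linear F" "\<And>x. F x \<le> p x"
proof -
  define A where "A = {q. sublinear q \<and> (\<forall>x. q x \<le> p x)}"
  \<comment> \<open>The order is reversed, so that a maximal element for \<open>?P\<close> is a
    minimal functional.\<close>
  let ?P = "\<lambda>a b :: 'v \<Rightarrow> real. b \<le> a"
  have "\<exists>m\<in>A. \<forall>a\<in>A. ?P m a \<longrightarrow> a = m"
  proof (rule predicate_Zorn)
    show "partial_order_on A (relation_of ?P A)"
      by (rule partial_order_on_relation_ofI) auto
  next
    fix C assume C: "C \<in> Chains (relation_of ?P A)"
    show "\<exists>u\<in>A. \<forall>a\<in>C. ?P a u"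
    proof (cases "C = {}")
      case True
      then show ?thesis using p by (auto simp: A_def)
    next
      case False
      have CA: "sublinear q" "q x \<le> p x" if "q \<in> C" for q x
        using C that by (auto simp: Chains_def relation_of_def A_def)
      have chain: "a \<le> b \<or> b \<le> a" if "a \<in> C" "b \<in> C" for a b
        using C that by (auto simp: Chains_def relation_of_def)
      define u where "u x = (INF q\<in>C. q x)" for x
      \<comment> \<open>Every functional below \<open>p\<close> is at least \<open>- p (- x)\<close>
        at \<open>x\<close>, so the infimum over the chain is a genuine real infimum.\<close>
      have bdd: "bdd_below ((\<lambda>q. q x) ` C)" for x
      proof (rule bdd_belowI2[where m = "- p (- x)"])
        fix q assume "q \<in> C"
        then show "- p (- x) \<le> q x"
          using sublinear_minus[OF CA(1), of q x] CA(2)[of q "- x"] by simp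
      qed
      have le: "u x \<le> q x" if "q \<in> C" for q x
        unfolding u_def by (rule cINF_lower[OF bdd that])
      have ge: "m \<le> u x" if "\<And>q. q \<in> C \<Longrightarrow> m \<le> q x" for m x
        unfolding u_def using False that by (intro cINF_greatest) auto
      have "sublinear u"
        unfolding sublinear_def
      proof (intro conjI allI impI)
        show "u 0 = 0"
        proof (rule antisym)
          obtain q where q: "q \<in> C" using False by blast
          show "u 0 \<le> 0" using le[OF q, of 0] sublinear_0[OF CA(1)[OF q]] by simp
          show "0 \<le> u 0" by (rule ge) (use sublinear_0[OF CA(1)] in \<open>metis order_refl\<close>)
        qed
      next
        fix x y
        have "u (x + y) - u y \<le> a x" if a: "a \<in> C" for a
        proof -
          have "u (x + y) - a x \<le> b y" if b: "b \<in> C" for b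
          proof -
            \<comment> \<open>Here the chain property matters: the smaller of \<open>a\<close> and
              \<open>b\<close> serves at both points, so subadditivity of a single functional
              suffices.\<close>
            obtain m where m: "m \<in> C" "m \<le> a" "m \<le> b"
              using chain[OF a b] a b by blast
            have "u (x + y) \<le> m x + m y"
              using le[OF m(1), of "x + y"] sublinear_add[OF CA(1)[OF m(1)], of x y] by simp
            then show ?thesis
              using le_funD[OF m(2), of x] le_funD[OF m(3), of y] by simp
          qed
          then have "u (x + y) - a x \<le> u y" by (rule ge)
          then show ?thesis by simp
        qed
        then have "u (x + y) - u y \<le> u x" by (rule ge)
        then show "u (x + y) \<le> u x + u y" by simp
      next
        fix c :: real and x assume c: "c > 0"
        have "u (c *\<^sub>R x) / c \<le> q x" if "q \<in> C" for q
          using le[OF that, of "c *\<^sub>R x"] sublinear_scaleR[OF CA(1)[OF that] c] c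
          by (simp add: field_simps)
        then have "u (c *\<^sub>R x) / c \<le> u x" by (rule ge)
        then show "u (c *\<^sub>R x) \<le> c * u x" using c by (simp add: field_simps)
      qed
      moreover have "u x \<le> p x" for x
      proof -
        obtain q where q: "q \<in> C" using False by blast
        show ?thesis using le[OF q, of x] CA(2)[OF q, of x] by simp
      qed
      ultimately show ?thesis
        using le by (intro bexI[where x = u]) (auto simp: A_def le_fun_def)
    qed
  qed
  then obtain m where m: "m \<in> A" "\<And>a. a \<in> A \<Longrightarrow> a \<le> m \<Longrightarrow> a = m" by blast
  have "linear m"
  proof (rule minimal_sublinear_linear)
    show "sublinear m" using m(1) by (simp add: A_def)
    fix q' assume q': "sublinear q'" "\<And>x. q' x \<le> m x"
    have "q' \<in> A"
      using q' m(1) unfolding A_def by (auto intro: order_trans)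
    then show "q' = m" using m(2) q'(2) by (simp add: le_fun_def)
  qed
  then show thesis using that m(1) by (simp add: A_def)
qed

text \<open>Any linear \<open>F\<close> below the lowered functional satisfies
  \<open>F (- fst z) \<le> - snd z\<close>, which is the lower bound on \<open>D\<close> after
  negation. When \<open>D\<close> is the graph of a linear functional on a subspace, applying the
  bound to \<open>- z\<close> as well gives equality, hence the usual extension theorem.\<close>

lemma hahn_banach_cone:
  fixes p :: "'v::real_vector \<Rightarrow> real" and D :: "('v \<times> real) set"
  assumes "sublinear p"
    and "0 \<in> D"
    and "\<And>z w. z \<in> D \<Longrightarrow> w \<in> D \<Longrightarrow> z + w \<in> D"
    and "\<And>c z. c > 0 \<Longrightarrow> z \<in> D \<Longrightarrow> c *\<^sub>R z \<in> D"
    and "\<And>z. z \<in> D \<Longrightarrow> snd z \<le> p (fst z)"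
  shows "\<exists>F. linear F \<and> (\<forall>x. F x \<le> p x) \<and> (\<forall>z\<in>D. snd z \<le> F (fst z))"
proof -
  obtain q where q: "sublinear q" "\<And>x. q x \<le> p x" "\<And>z. z \<in> D \<Longrightarrow> q (- fst z) \<le> - snd z"
    using sublinear_lower_cone[OF assms] by blast
  obtain F where F: "linear F" "\<And>x. F x \<le> q x"
    using linear_below_sublinear[OF q(1)] by blast
  have "F x \<le> p x" for x
    using F(2)[of x] q(2)[of x] by simp
  moreover have "snd z \<le> F (fst z)" if "z \<in> D" for z
    using F(2)[of "- fst z"] q(3)[OF that] linear_neg[OF F(1), of "fst z"] by simp
  ultimately show ?thesis using F(1) by blast
qed

subsection \<open>Invariant means on bounded functions\<close>

text \<open>On a discrete space every function is continuous, so the bounded functions on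
  \<open>'c\<close> become a type that is a real vector space, as the extension theorem
  requires.\<close>

definition bounded_fun :: "('c \<Rightarrow> real) \<Rightarrow> 'c discrete \<Rightarrow>\<^sub>C real" where
  "bounded_fun h = Bcontfun (\<lambda>x. h (of_discrete x))"

lemma apply_bounded_fun:
  assumes "bounded (range h)"
  shows "apply_bcontfun (bounded_fun h) x = h (of_discrete x)"
proof -
  have "continuous_on UNIV (\<lambda>x. h (of_discrete x))"
    by (simp add: continuous_on_open_vimage open_discrete)
  moreover have "bounded (range (\<lambda>x. h (of_discrete x)))"
    using assms by (rule bounded_subset) auto
  ultimately show ?thesis
    unfolding bounded_fun_def by (subst Bcontfun_inverse) (auto simp: bcontfun_def)
qed

text \<open>The laws concern bounded functions only. Positivity and total mass one are implied by
  the upper bound, applied to negated functions and to constants.\<close>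

definition invariant_mean :: "('c \<Rightarrow> 'c) set \<Rightarrow> (('c \<Rightarrow> real) \<Rightarrow> real) \<Rightarrow> bool" where
  "invariant_mean G F \<longleftrightarrow>
    (\<forall>f g. bounded (range f) \<longrightarrow> bounded (range g) \<longrightarrow> F (\<lambda>x. f x + g x) = F f + F g) \<and>
    (\<forall>c f. bounded (range f) \<longrightarrow> F (\<lambda>x. c * f x) = c * F f) \<and>
    (\<forall>c f. bounded (range f) \<longrightarrow> (\<forall>x. f x \<le> c) \<longrightarrow> F f \<le> c) \<and>
    (\<forall>\<rho>\<in>G. \<forall>f. bounded (range f) \<longrightarrow> F (\<lambda>x. f (\<rho> x)) = F f)"

lemma
  assumes "invariant_mean G F" "bounded (range f)"
  shows invariant_mean_add: "bounded (range g) \<Longrightarrow> F (\<lambda>x. f x + g x) = F f + F g"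
    and invariant_mean_scale: "F (\<lambda>x. c * f x) = c * F f"
    and invariant_mean_le: "(\<And>x. f x \<le> c) \<Longrightarrow> F f \<le> c"
    and invariant_mean_inv: "\<rho> \<in> G \<Longrightarrow> F (\<lambda>x. f (\<rho> x)) = F f"
  using assms by (auto simp: invariant_mean_def)

text \<open>Every linear functional below the supremum of the \<open>G\<close>-average is a mean,
  and it is invariant because a function and its translate have the same average. The pairs in
  \<open>D\<close> prescribe values on a subspace; \<open>dom\<close> is the domination needed to
  extend them.\<close>

lemma invariant_mean_exists:
  fixes G :: "('c \<Rightarrow> 'c) set" and D :: "(('c \<Rightarrow> real) \<times> real) set"
  assumes G: "finite G" "G \<noteq> {}" "\<And>\<rho> \<pi>. \<rho> \<in> G \<Longrightarrow> \<pi> \<in> G \<Longrightarrow> \<rho> \<circ> \<pi> \<in> G" "\<And>\<rho>. \<rho> \<in> G \<Longrightarrow> inj \<rho>"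
    and D0: "(\<lambda>_. 0, 0) \<in> D"
    and Dadd: "\<And>f g r s. (f, r) \<in> D \<Longrightarrow> (g, s) \<in> D \<Longrightarrow> (\<lambda>x. f x + g x, r + s) \<in> D"
    and Dscale: "\<And>c g r. (g, r) \<in> D \<Longrightarrow> (\<lambda>x. c * g x, c * r) \<in> D"
    and Dbdd: "\<And>g r. (g, r) \<in> D \<Longrightarrow> bounded (range g)"
    and dom: "\<And>g r. (g, r) \<in> D \<Longrightarrow> r \<le> (SUP x. (\<Sum>\<pi>\<in>G. g (\<pi> x)) / card G)"
  shows "\<exists>F. invariant_mean G F \<and> (\<forall>(g, r)\<in>D. F g = r)"
proof -
  have card: "real (card G) > 0" using G by (simp add: card_gt_0_iff)
  define avg where "avg h x = (\<Sum>\<pi>\<in>G. h (\<pi> x)) / card G" for h :: "'c \<Rightarrow> real" and x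
  define p where "p h = (SUP x. avg (\<lambda>y. apply_bcontfun h (discrete y)) x)" for h
  have avg_add: "avg (\<lambda>x. f x + g x) x = avg f x + avg g x" for f g x
    by (simp add: avg_def sum.distrib add_divide_distrib)
  have avg_scale: "avg (\<lambda>x. c * f x) x = c * avg f x" for c f x
    by (simp add: avg_def sum_distrib_left)
  have avg_le: "avg h x \<le> c" if "\<And>y. h y \<le> c" for h x c
    using sum_bounded_above[of G "\<lambda>\<pi>. h (\<pi> x)" c] that card by (simp add: avg_def field_simps)
  have p_least: "p h \<le> c" if "\<And>x. avg (\<lambda>y. apply_bcontfun h (discrete y)) x \<le> c" for h c
    unfolding p_def by (rule cSUP_least) (use that in auto)
  have p_upper: "avg (\<lambda>y. apply_bcontfun h (discrete y)) x \<le> p h" for h x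
    unfolding p_def
  proof (rule cSUP_upper)
    have "bounded (range (apply_bcontfun h))" by simp
    then obtain c where "\<And>y. apply_bcontfun h y \<le> c"
      unfolding bounded_iff by (metis abs_le_D1 rangeI real_norm_def)
    then show "bdd_above (range (avg (\<lambda>y. apply_bcontfun h (discrete y))))"
      by (intro bdd_aboveI2[where M = c] avg_le)
  qed simp
  have "sublinear p"
    unfolding sublinear_def
  proof (intro conjI allI impI)
    show "p 0 = 0" by (simp add: p_def avg_def zero_bcontfun.rep_eq)
  next
    fix f g
    show "p (f + g) \<le> p f + p g"
      by (rule p_least) (simp add: plus_bcontfun.rep_eq avg_add add_mono p_upper)
  next
    fix c :: real and f assume "c > 0"
    then show "p (c *\<^sub>R f) \<le> c * p f"
      by (intro p_least) (simp add: scaleR_bcontfun.rep_eq avg_scale p_upper)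
  qed
  define D' where "D' = {(bounded_fun g, r) | g r. (g, r) \<in> D}"
  have bf: "bounded_fun (\<lambda>x. f x + g x) = bounded_fun f + bounded_fun g"
    if "bounded (range f)" "bounded (range g)" for f g :: "'c \<Rightarrow> real"
    using that by (intro bcontfun_eqI)
      (simp add: apply_bounded_fun bounded_plus_comp plus_bcontfun.rep_eq)
  have bf_scale: "bounded_fun (\<lambda>x. c * f x) = c *\<^sub>R bounded_fun f"
    if "bounded (range f)" for c and f :: "'c \<Rightarrow> real"
    using that bounded_scaleR_comp[of f UNIV c] by (intro bcontfun_eqI)
      (simp add: apply_bounded_fun scaleR_bcontfun.rep_eq)
  have "\<exists>F. linear F \<and> (\<forall>x. F x \<le> p x) \<and> (\<forall>z\<in>D'. snd z \<le> F (fst z))"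
  proof (rule hahn_banach_cone[OF \<open>sublinear p\<close>, of D'])
    have "bounded_fun (\<lambda>x. 0) = (0 :: 'c discrete \<Rightarrow>\<^sub>C real)"
      by (intro bcontfun_eqI) (simp add: apply_bounded_fun zero_bcontfun.rep_eq image_constant_conv)
    then show "0 \<in> D'" using D0 by (force simp: D'_def zero_prod_def)
    show "z + w \<in> D'" if zw: "z \<in> D'" "w \<in> D'" for z w
    proof -
      obtain f r g s where "z = (bounded_fun f, r)" "w = (bounded_fun g, s)" "(f, r) \<in> D" "(g, s) \<in> D"
        using zw unfolding D'_def by blast
      then show ?thesis using Dadd[of f r g s] bf[of f g] Dbdd by (force simp: D'_def)
    qed
    show "c *\<^sub>R z \<in> D'" if z: "c > 0" "z \<in> D'" for c z
    proof -
      obtain f r where "z = (bounded_fun f, r)" "(f, r) \<in> D"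
        using z unfolding D'_def by blast
      then show ?thesis using Dscale[of f r c] bf_scale[of f c] Dbdd by (force simp: D'_def)
    qed
    show "snd z \<le> p (fst z)" if z: "z \<in> D'" for z
    proof -
      obtain f r where "z = (bounded_fun f, r)" "(f, r) \<in> D"
        using z unfolding D'_def by blast
      then show ?thesis
        using dom[of f r] Dbdd[of f r] by (simp add: p_def avg_def apply_bounded_fun discrete_inverse)
    qed
  qed
  then obtain F where F: "linear F" "\<And>x. F x \<le> p x" "\<And>z. z \<in> D' \<Longrightarrow> snd z \<le> F (fst z)"
    by blast
  have F_scale: "F (bounded_fun (\<lambda>x. c * f x)) = c * F (bounded_fun f)" if "bounded (range f)" for c f
    using bf_scale[OF that] linear_scale[OF F(1)] by simp
  have F_le: "F (bounded_fun f) \<le> c" if "bounded (range f)" "\<And>x. avg f x \<le> c" for f c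
  proof -
    have "p (bounded_fun f) \<le> c"
      by (rule p_least) (use that in \<open>simp add: apply_bounded_fun discrete_inverse\<close>)
    then show ?thesis using F(2)[of "bounded_fun f"] by simp
  qed
  have "invariant_mean G (\<lambda>f. F (bounded_fun f))"
    unfolding invariant_mean_def
  proof (intro conjI allI impI ballI)
    fix f g :: "'c \<Rightarrow> real" assume "bounded (range f)" "bounded (range g)"
    then show "F (bounded_fun (\<lambda>x. f x + g x)) = F (bounded_fun f) + F (bounded_fun g)"
      by (simp add: bf linear_add[OF F(1)])
  next
    fix f :: "'c \<Rightarrow> real" and c assume "bounded (range f)"
    then show "F (bounded_fun (\<lambda>x. c * f x)) = c * F (bounded_fun f)" by (rule F_scale)
  next
    fix f :: "'c \<Rightarrow> real" and c assume "bounded (range f)" "\<forall>x. f x \<le> c"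
    then show "F (bounded_fun f) \<le> c" using F_le avg_le by blast
  next
    fix f :: "'c \<Rightarrow> real" and \<rho> assume \<rho>: "\<rho> \<in> G" and f: "bounded (range f)"
    \<comment> \<open>\<open>G\<close> is given as a finite semigroup of injections. Left
      composition with \<open>\<rho>\<close> is injective and maps the finite set \<open>G\<close>
      into itself, hence permutes it, and the average can be reindexed.\<close>
    have "inj_on ((\<circ>) \<rho>) G" using fun.inj_map[OF G(4)[OF \<rho>]] by (rule inj_on_subset) simp
    moreover have "(\<circ>) \<rho> ` G \<subseteq> G" using G(3) \<rho> by auto
    ultimately have "bij_betw ((\<circ>) \<rho>) G G"
      using G(1) by (simp add: bij_betw_def endo_inj_surj)
    then have avg: "avg (\<lambda>x. f (\<rho> x)) x = avg f x" for x
      unfolding avg_def using sum.reindex_bij_betw[of "(\<circ>) \<rho>" G G "\<lambda>\<pi>. f (\<pi> x)"] by simp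
    have bdd: "bounded (range (\<lambda>x. f (\<rho> x)))" using f by (rule bounded_subset) auto
    \<comment> \<open>If two functions have the same average, their difference has average 0, so
      \<open>F\<close> of the difference is at most 0; exchanging the two functions gives
      equality.\<close>
    have diff: "F (bounded_fun g) \<le> F (bounded_fun h)"
      if gh: "bounded (range g)" "bounded (range h)" "\<And>x. avg g x = avg h x" for g h
    proof -
      have "bounded (range (\<lambda>x. -1 * h x))"
        using bounded_scaleR_comp[OF gh(2), of "-1"] by simp
      then have "F (bounded_fun g) - F (bounded_fun h) = F (bounded_fun (\<lambda>x. g x + -1 * h x))"
        using gh bf[OF gh(1), of "\<lambda>x. -1 * h x"] F_scale[OF gh(2), of "-1"] linear_add[OF F(1)] by simp
      also have "\<dots> \<le> 0"
      proof (rule F_le)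
        show "bounded (range (\<lambda>x. g x + -1 * h x))"
          using gh(1) \<open>bounded (range (\<lambda>x. -1 * h x))\<close> by (rule bounded_plus_comp)
        show "avg (\<lambda>x. g x + -1 * h x) x \<le> 0" for x
          unfolding avg_add avg_scale gh(3) by simp
      qed
      finally show ?thesis by simp
    qed
    show "F (bounded_fun (\<lambda>x. f (\<rho> x))) = F (bounded_fun f)"
      using diff[OF bdd f avg] diff[OF f bdd avg[symmetric]] by simp
  qed
  moreover have "F (bounded_fun g) = r" if gr: "(g, r) \<in> D" for g r
  proof -
    \<comment> \<open>The extension yields only a lower bound; since \<open>D\<close> is closed
      under the factor -1, the bound for the negated pair is the reverse inequality.\<close>
    have ge: "r \<le> F (bounded_fun g)" if "(g, r) \<in> D" for g r
      using that F(3)[of "(bounded_fun g, r)"] by (auto simp: D'_def)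
    show ?thesis
      using ge[OF gr] ge[OF Dscale[OF gr, of "-1"]] F_scale[OF Dbdd[OF gr], of "-1"] by simp
  qed
  ultimately show ?thesis by (intro exI[of _ "\<lambda>f. F (bounded_fun f)"]) auto
qed

subsection \<open>Permutations, injections and U-statistics\<close>

text \<open>This lets invariance under permutations act on each term of a U-statistic. The
  complements of \<open>{..<n}\<close> and of its image have equal size, so a bijection between them
  completes \<open>\<sigma>\<close>.\<close>

lemma extend_injection_to_permutation:
  assumes "\<sigma> \<in> injs n N" "n \<le> N"
  obtains \<pi> where "\<pi> permutes {..<N}" "\<And>i. i < n \<Longrightarrow> \<pi> i = \<sigma> i"
proof -
  have \<sigma>: "inj_on \<sigma> {..<n}" "\<sigma> ` {..<n} \<subseteq> {..<N}"
    using assms(1) by (auto simp: injs_def)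
  then have "card ({..<N} - {..<n}) = card ({..<N} - \<sigma> ` {..<n})"
    using assms(2) by (simp add: card_Diff_subset card_image)
  then obtain h where h: "bij_betw h ({..<N} - {..<n}) ({..<N} - \<sigma> ` {..<n})"
    using finite_same_card_bij[of "{..<N} - {..<n}" "{..<N} - \<sigma> ` {..<n}"] by auto
  define \<pi> where "\<pi> i = (if i < n then \<sigma> i else if i < N then h i else i)" for i
  have 1: "bij_betw \<pi> {..<n} (\<sigma> ` {..<n})"
    using inj_on_imp_bij_betw[OF \<sigma>(1)] by (rule bij_betw_cong[THEN iffD2, rotated]) (simp add: \<pi>_def)
  have 2: "bij_betw \<pi> ({..<N} - {..<n}) ({..<N} - \<sigma> ` {..<n})"
    using h by (rule bij_betw_cong[THEN iffD2, rotated]) (simp add: \<pi>_def)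
  have "bij_betw \<pi> ({..<n} \<union> ({..<N} - {..<n})) (\<sigma> ` {..<n} \<union> ({..<N} - \<sigma> ` {..<n}))"
    by (rule bij_betw_combine[OF 1 2]) auto
  moreover have "{..<n} \<union> ({..<N} - {..<n}) = {..<N}" "\<sigma> ` {..<n} \<union> ({..<N} - \<sigma> ` {..<n}) = {..<N}"
    using \<sigma>(2) assms(2) by auto
  ultimately have "bij_betw \<pi> {..<N} {..<N}" by simp
  then have "\<pi> permutes {..<N}"
    by (rule bij_imp_permutes) (use assms(2) in \<open>auto simp: \<pi>_def\<close>)
  then show thesis by (rule that) (simp add: \<pi>_def)
qed

lemma finite_injs: "finite (injs n N)"
  by (rule finite_subset[OF _ finite_PiE[of "{..<n}" "\<lambda>_. {..<N}"]]) (auto simp: injs_def)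

lemma card_injs: "real (card (injs n N)) = falling N n"
proof -
  have "card (injs n N) = (\<Prod>k<n. N - k)"
    using card_inj_on_subset_funcset[of "{..<n}" "{..<N}" "{..<n}"]
    by (simp add: injs_def atLeast0LessThan)
  then show ?thesis by (simp add: falling_def)
qed

lemma falling_pos: "n \<le> N \<Longrightarrow> falling N n > 0"
  unfolding falling_def by (intro prod_pos) auto

text \<open>Used to reindex the sum in \<open>U\<close>. The restriction restores the extensionality
  that membership in \<open>injs n N\<close> demands.\<close>

lemma bij_betw_injs_permutes:
  assumes \<pi>: "\<pi> permutes {..<N}"
  shows "bij_betw (\<lambda>\<sigma>. restrict (\<pi> \<circ> \<sigma>) {..<n}) (injs n N) (injs n N)"
proof -
  let ?f = "\<lambda>\<sigma>. restrict (\<pi> \<circ> \<sigma>) {..<n}"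
  have inj\<pi>: "inj \<pi>" using \<pi> by (rule permutes_inj)
  have "inj_on ?f (injs n N)"
  proof (rule inj_onI)
    fix \<sigma> \<tau> assume st: "\<sigma> \<in> injs n N" "\<tau> \<in> injs n N" "?f \<sigma> = ?f \<tau>"
    have "\<sigma> i = \<tau> i" if "i \<in> {..<n}" for i
      using fun_cong[OF st(3), of i] that injD[OF inj\<pi>] by simp
    then show "\<sigma> = \<tau>"
      using st(1,2) unfolding injs_def by (intro PiE_ext[of \<sigma> "{..<n}" "\<lambda>_. {..<N}"]) auto
  qed
  moreover have "?f ` injs n N \<subseteq> injs n N"
  proof (rule image_subsetI)
    fix \<sigma> assume \<sigma>: "\<sigma> \<in> injs n N"
    have "\<pi> (\<sigma> i) < N" if "i < n" for i
      using \<sigma> permutes_in_image[OF \<pi>, of "\<sigma> i"] that by (auto simp: injs_def PiE_iff)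
    moreover have "inj_on (\<pi> \<circ> \<sigma>) {..<n}"
      using \<sigma> by (intro comp_inj_on inj_on_subset[OF inj\<pi>]) (auto simp: injs_def)
    ultimately show "?f \<sigma> \<in> injs n N"
      by (auto simp: injs_def inj_on_def)
  qed
  ultimately show ?thesis
    using finite_injs by (simp add: bij_betw_def endo_inj_surj)
qed

text \<open>Permuting the coordinates only reorders the sum over injections. An injection takes an
  arbitrary default value outside \<open>{..<n}\<close>, so \<open>g\<close> must ignore all
  coordinates from \<open>n\<close> on.\<close>

lemma U_permute:
  assumes "\<pi> permutes {..<N}" and g: "\<And>x y. (\<And>i. i < n \<Longrightarrow> x i = y i) \<Longrightarrow> g x = g y"
  shows "U N n g (x \<circ> \<pi>) = U N n g x"
proof -
  have "(\<Sum>\<sigma>\<in>injs n N. g (\<lambda>i. (x \<circ> \<pi>) (\<sigma> i))) =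
      (\<Sum>\<sigma>\<in>injs n N. g (\<lambda>i. x (restrict (\<pi> \<circ> \<sigma>) {..<n} i)))"
    by (intro sum.cong refl g) simp
  also have "\<dots> = (\<Sum>\<sigma>\<in>injs n N. g (\<lambda>i. x (\<sigma> i)))"
    by (rule sum.reindex_bij_betw[OF bij_betw_injs_permutes[OF assms(1)]])
  finally show ?thesis by (simp add: U_def)
qed

lemma U_add: "U N n (\<lambda>x. f x + g x) x = U N n f x + U N n g x"
  by (simp add: U_def sum.distrib distrib_left)

lemma U_scale: "U N n (\<lambda>x. c * f x) x = c * U N n f x"
  by (simp add: U_def sum_distrib_left mult.left_commute)

lemma U_const: "n \<le> N \<Longrightarrow> U N n (\<lambda>x. c) x = c"
  using falling_pos[of n N] by (simp add: U_def card_injs)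

lemma abs_U_le:
  assumes "n \<le> N" "\<And>x. \<bar>g x\<bar> \<le> c"
  shows "\<bar>U N n g x\<bar> \<le> c"
proof -
  have "\<bar>\<Sum>\<sigma>\<in>injs n N. g (\<lambda>i. x (\<sigma> i))\<bar> \<le> (\<Sum>\<sigma>\<in>injs n N. \<bar>g (\<lambda>i. x (\<sigma> i))\<bar>)"
    by (rule sum_abs)
  also have "\<dots> \<le> falling N n * c"
    using sum_bounded_above[of "injs n N" "\<lambda>\<sigma>. \<bar>g (\<lambda>i. x (\<sigma> i))\<bar>" c] assms(2) by (simp add: card_injs)
  finally show ?thesis
    using falling_pos[OF assms(1)] by (simp add: U_def abs_mult field_simps)
qed

section \<open>Linear combinations of indicators of rectangles\<close>

definition rect_ind :: "nat \<Rightarrow> (nat \<Rightarrow> 'a set) \<Rightarrow> (nat \<Rightarrow> 'a) \<Rightarrow> real" where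
  "rect_ind n V x = (\<Prod>i<n. indicator (V i) (x i))"

lemma rect_ind_eq: "rect_ind n V x = indicator {x. \<forall>i<n. x i \<in> V i} x"
proof (cases "\<forall>i<n. x i \<in> V i")
  case False
  then obtain i where "i < n" "x i \<notin> V i" by blast
  then have "rect_ind n V x = 0" unfolding rect_ind_def by (intro prod_zero) (auto intro!: bexI[of _ i])
  then show ?thesis using False by simp
qed (simp add: rect_ind_def)

lemma simple_rect_fun_iff:
  "g \<in> simple_rect_fun S0 n \<longleftrightarrow> (\<exists>(m::nat) c V. (\<forall>j<m. \<forall>i<n. V j i \<in> S0) \<and>
     g = (\<lambda>x. \<Sum>j<m. c j * rect_ind n (V j) x))"
  unfolding simple_rect_fun_def rect_ind_def by blast

lemma rect_ind_in_simple_rect_fun: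
  assumes "\<And>i. i < n \<Longrightarrow> V i \<in> S0"
  shows "rect_ind n V \<in> simple_rect_fun S0 n"
  unfolding simple_rect_fun_iff using assms
  by (intro exI[of _ 1] exI[of _ "\<lambda>_. 1"] exI[of _ "\<lambda>_. V"]) auto

lemma const_in_simple_rect_fun:
  assumes "UNIV \<in> S0"
  shows "(\<lambda>_. c) \<in> simple_rect_fun S0 n"
  unfolding simple_rect_fun_iff using assms
  by (intro exI[of _ 1] exI[of _ "\<lambda>_. c"] exI[of _ "\<lambda>_ _. UNIV"]) (auto simp: rect_ind_def)

lemma simple_rect_fun_scale:
  assumes "g \<in> simple_rect_fun S0 n"
  shows "(\<lambda>x. c * g x) \<in> simple_rect_fun S0 n"
proof -
  obtain m :: nat and d V where "\<forall>j<m. \<forall>i<n. V j i \<in> S0" "g = (\<lambda>x. \<Sum>j<m. d j * rect_ind n (V j) x)"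
    using assms unfolding simple_rect_fun_iff by blast
  then show ?thesis
    unfolding simple_rect_fun_iff
    by (intro exI[of _ m] exI[of _ "\<lambda>j. c * d j"] exI[of _ V]) (simp add: sum_distrib_left mult.assoc)
qed

lemma sum_lessThan_add:
  fixes f :: "nat \<Rightarrow> 'b::comm_monoid_add"
  shows "(\<Sum>j<m + k. f j) = (\<Sum>j<m. f j) + (\<Sum>j<k. f (m + j))"
  by (induction k) (simp_all add: ac_simps)

lemma simple_rect_fun_add:
  assumes "f \<in> simple_rect_fun S0 n" "g \<in> simple_rect_fun S0 n"
  shows "(\<lambda>x. f x + g x) \<in> simple_rect_fun S0 n"
proof -
  obtain m :: nat and c V where f: "\<forall>j<m. \<forall>i<n. V j i \<in> S0" "f = (\<lambda>x. \<Sum>j<m. c j * rect_ind n (V j) x)"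
    using assms(1) unfolding simple_rect_fun_iff by blast
  obtain k :: nat and d W where g: "\<forall>j<k. \<forall>i<n. W j i \<in> S0" "g = (\<lambda>x. \<Sum>j<k. d j * rect_ind n (W j) x)"
    using assms(2) unfolding simple_rect_fun_iff by blast
  show ?thesis
    unfolding simple_rect_fun_iff
  proof (intro exI conjI)
    \<comment> \<open>The two lists of terms are concatenated; the second one is read with its index
      shifted by \<open>m\<close>.\<close>
    show "\<forall>j<m + k. \<forall>i<n. (if j < m then V j else W (j - m)) i \<in> S0"
      using f(1) g(1) by auto
    show "(\<lambda>x. f x + g x) = (\<lambda>x. \<Sum>j<m + k. (if j < m then c j else d (j - m)) *
        rect_ind n (if j < m then V j else W (j - m)) x)"
      unfolding sum_lessThan_add f(2) g(2) by simp
  qed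
qed

lemma simple_rect_fun_cong:
  assumes "g \<in> simple_rect_fun S0 n" "\<And>i. i < n \<Longrightarrow> x i = y i"
  shows "g x = g y"
proof -
  have "rect_ind n V x = rect_ind n V y" for V
    unfolding rect_ind_def by (intro prod.cong) (simp_all add: assms(2))
  then show ?thesis using assms(1) unfolding simple_rect_fun_iff by auto
qed

lemma simple_rect_fun_bounded:
  assumes "g \<in> simple_rect_fun S0 n"
  obtains c where "\<And>x. \<bar>g x\<bar> \<le> c"
proof -
  obtain m :: nat and c V where g: "g = (\<lambda>x. \<Sum>j<m. c j * rect_ind n (V j) x)"
    using assms unfolding simple_rect_fun_iff by blast
  have "\<bar>g x\<bar> \<le> (\<Sum>j<m. \<bar>c j\<bar>)" for x
    unfolding g rect_ind_eq
    by (rule sum_abs[THEN order_trans], rule sum_mono) (simp add: abs_mult indicator_def)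
  then show thesis by (rule that)
qed

section \<open>An exchangeable finitely additive probability\<close>

text \<open>The values \<open>e g\<close> are prescribed on the functions \<open>U N n g\<close> and
  extended to an invariant mean \<open>F\<close>. Invariance then brings \<open>e\<close> back to
  \<open>g\<close> itself: all terms of \<open>U N n g\<close> have the same mean as
  \<open>g\<close>, so \<open>F g = F (U N n g) = e g\<close> for rectangle indicators.\<close>

lemma exchangeable_charge:
  fixes e :: "((nat \<Rightarrow> 'a) \<Rightarrow> real) \<Rightarrow> real"
  assumes nN: "n \<le> N"
    and e_add: "\<And>f g. f \<in> simple_rect_fun S0 n \<Longrightarrow> g \<in> simple_rect_fun S0 n \<Longrightarrow>
      e (\<lambda>x. f x + g x) = e f + e g"
    and e_scale: "\<And>c g. g \<in> simple_rect_fun S0 n \<Longrightarrow> e (\<lambda>x. c * g x) = c * e g"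
    and e_le: "\<And>g. g \<in> simple_rect_fun S0 n \<Longrightarrow> e g \<le> (SUP x. U N n g x)"
  shows "\<exists>\<mu> :: (nat \<Rightarrow> 'a) set \<Rightarrow> real.
    (\<forall>A. \<mu> A \<ge> 0) \<and> (\<forall>A B. A \<inter> B = {} \<longrightarrow> \<mu> (A \<union> B) = \<mu> A + \<mu> B) \<and> \<mu> UNIV = 1 \<and>
    (\<forall>\<pi> A. \<pi> permutes {..<N} \<longrightarrow> \<mu> {x. x \<circ> \<pi> \<in> A} = \<mu> A) \<and>
    (\<forall>V. (\<forall>i<n. V i \<in> S0) \<longrightarrow> \<mu> {x. \<forall>i<n. x i \<in> V i} = e (rect_ind n V))"
proof -
  define G where "G = (\<lambda>\<pi> (x :: nat \<Rightarrow> 'a). x \<circ> \<pi>) ` {\<pi>. \<pi> permutes {..<N}}"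
  \<comment> \<open>A relation avoids choosing a representative \<open>g\<close>. It is
    single-valued anyway: if \<open>U N n g\<close> vanishes, then \<open>e_le\<close> for
    \<open>g\<close> and for its negative forces \<open>e g = 0\<close>.\<close>
  define D where "D = {(U N n g, e g) | g. g \<in> simple_rect_fun S0 n}"
  have DE: thesis if "(h, r) \<in> D"
    "\<And>g. g \<in> simple_rect_fun S0 n \<Longrightarrow> h = U N n g \<Longrightarrow> r = e g \<Longrightarrow> thesis" for h r thesis
    using that by (auto simp: D_def)
  have DI: "(U N n g, e g) \<in> D" if "g \<in> simple_rect_fun S0 n" for g
    using that by (auto simp: D_def)
  have zero: "(\<lambda>_. 0) \<in> simple_rect_fun S0 n"
    unfolding simple_rect_fun_iff by (intro exI[of _ 0]) simp
  have bdd_U: "bounded (range (U N n g))" if g: "g \<in> simple_rect_fun S0 n" for g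
  proof -
    obtain c where c: "\<And>x. \<bar>g x\<bar> \<le> c" using simple_rect_fun_bounded[OF g] by blast
    show ?thesis by (rule boundedI[of _ c]) (use abs_U_le[OF nN c] in auto)
  qed
  have card: "real (card G) > 0"
    unfolding G_def using permutes_id[of "{..<N}"]
    by (auto simp: card_gt_0_iff finite_permutations simp del: permutes_id)
  have G_fin: "finite G" by (simp add: G_def finite_permutations)
  have G_ne: "G \<noteq> {}" using card by auto
  have G_comp: "\<rho> \<circ> \<pi> \<in> G" if \<rho>\<pi>: "\<rho> \<in> G" "\<pi> \<in> G" for \<rho> \<pi>
  proof -
    obtain p q where "p permutes {..<N}" "q permutes {..<N}" "\<rho> = (\<lambda>x. x \<circ> p)" "\<pi> = (\<lambda>x. x \<circ> q)"
      using \<rho>\<pi> by (auto simp: G_def)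
    then show ?thesis
      \<comment> \<open>Permutations act by precomposition, so composing the actions reverses the
        order of \<open>p\<close> and \<open>q\<close>.\<close>
      unfolding G_def by (intro image_eqI[of _ _ "q \<circ> p"]) (auto simp: permutes_compose fun_eq_iff)
  qed
  have G_inj: "inj \<rho>" if \<rho>: "\<rho> \<in> G" for \<rho>
  proof -
    obtain p where p: "p permutes {..<N}" "\<rho> = (\<lambda>x. x \<circ> p)"
      using \<rho> by (auto simp: G_def)
    show ?thesis
    proof (rule injI)
      fix x y assume "\<rho> x = \<rho> y"
      then have "x \<circ> p \<circ> inv p = y \<circ> p \<circ> inv p" using p(2) by simp
      then show "x = y" by (simp only: comp_assoc permutes_inv_o[OF p(1)] comp_id)
    qed
  qed
  have "e (\<lambda>x. 0) = 0" using e_scale[OF zero, of 0] by simp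
  moreover have "U N n (\<lambda>x :: nat \<Rightarrow> 'a. 0) = (\<lambda>_. 0)" by (simp add: fun_eq_iff U_def)
  ultimately have D_zero: "(\<lambda>_. 0, 0) \<in> D" using DI[OF zero] by simp
  have D_add: "(\<lambda>x. f x + g x, r + s) \<in> D" if "(f, r) \<in> D" "(g, s) \<in> D" for f g r s
  proof (rule DE[OF that(1)], rule DE[OF that(2)])
    fix f' g' assume *: "f' \<in> simple_rect_fun S0 n" "g' \<in> simple_rect_fun S0 n"
      "f = U N n f'" "r = e f'" "g = U N n g'" "s = e g'"
    have "(\<lambda>x. f x + g x) = U N n (\<lambda>x. f' x + g' x)" using * by (simp add: fun_eq_iff U_add)
    then show ?thesis using DI[OF simple_rect_fun_add[OF *(1,2)]] e_add[OF *(1,2)] * by simp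
  qed
  have D_scale: "(\<lambda>x. c * g x, c * r) \<in> D" if "(g, r) \<in> D" for c g r
  proof (rule DE[OF that])
    fix g' assume *: "g' \<in> simple_rect_fun S0 n" "g = U N n g'" "r = e g'"
    have "(\<lambda>x. c * g x) = U N n (\<lambda>x. c * g' x)" using * by (simp add: fun_eq_iff U_scale)
    then show ?thesis using DI[OF simple_rect_fun_scale[OF *(1)]] e_scale[OF *(1)] * by simp
  qed
  have D_bdd: "bounded (range g)" if "(g, r) \<in> D" for g r
    using that by (rule DE) (simp add: bdd_U)
  have D_dom: "r \<le> (SUP x. (\<Sum>\<pi>\<in>G. g (\<pi> x)) / card G)" if "(g, r) \<in> D" for g r
  proof (rule DE[OF that])
    fix g' assume *: "g' \<in> simple_rect_fun S0 n" "g = U N n g'" "r = e g'"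
    \<comment> \<open>U-statistics are symmetric, so averaging over \<open>G\<close> leaves them
      unchanged and the required domination reduces to \<open>e_le\<close>.\<close>
    have "g (\<pi> x) = g x" if \<pi>: "\<pi> \<in> G" for \<pi> x
    proof -
      obtain p where p: "p permutes {..<N}" "\<pi> = (\<lambda>x. x \<circ> p)" using \<pi> by (auto simp: G_def)
      have "U N n g' (x \<circ> p) = U N n g' x"
        by (rule U_permute[OF p(1)]) (rule simple_rect_fun_cong[OF *(1)])
      then show ?thesis using *(2) p(2) by simp
    qed
    then have "(\<Sum>\<pi>\<in>G. g (\<pi> x)) / card G = g x" for x using card by simp
    then show ?thesis using e_le[OF *(1)] * by simp
  qed
  have "\<exists>F. invariant_mean G F \<and> (\<forall>(g, r)\<in>D. F g = r)"
    by (rule invariant_mean_exists[OF G_fin G_ne G_comp G_inj D_zero D_add D_scale D_bdd D_dom])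
  then obtain F where F: "invariant_mean G F" and F_D: "\<forall>(g, r)\<in>D. F g = r"
    by blast
  note F_add = invariant_mean_add[OF F] and F_scale = invariant_mean_scale[OF F]
    and F_le = invariant_mean_le[OF F] and F_inv = invariant_mean_inv[OF F]
  define \<mu> where "\<mu> A = F (indicator A)" for A
  have bdd_ind: "bounded (range (indicator A :: (nat \<Rightarrow> 'a) \<Rightarrow> real))" for A
    by (rule boundedI[of _ 1]) (auto simp: indicator_def)
  have bdd_scale: "bounded (range (\<lambda>x. c * f x))" if "bounded (range f)" for c and f :: "(nat \<Rightarrow> 'a) \<Rightarrow> real"
    using bounded_scaleR_comp[OF that, of c] by simp
  have F_sum: "F (\<lambda>x. \<Sum>i\<in>I. f i x) = (\<Sum>i\<in>I. F (f i))" "bounded (range (\<lambda>x. \<Sum>i\<in>I. f i x))"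
    if "finite I" "\<And>i. i \<in> I \<Longrightarrow> bounded (range (f i))" for I :: "(nat \<Rightarrow> nat) set" and f :: "(nat \<Rightarrow> nat) \<Rightarrow> (nat \<Rightarrow> 'a) \<Rightarrow> real"
  proof -
    have "F (\<lambda>x. \<Sum>i\<in>I. f i x) = (\<Sum>i\<in>I. F (f i)) \<and> bounded (range (\<lambda>x. \<Sum>i\<in>I. f i x))"
      using that
    proof (induction I rule: finite_induct)
      case empty
      have "F (\<lambda>_. 0) = 0" using F_scale[OF bdd_ind, of 0] by simp
      then show ?case by (simp add: image_constant_conv)
    next
      case (insert i I)
      then show ?case by (simp add: F_add bounded_plus_comp)
    qed
    then show "F (\<lambda>x. \<Sum>i\<in>I. f i x) = (\<Sum>i\<in>I. F (f i))" "bounded (range (\<lambda>x. \<Sum>i\<in>I. f i x))"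
      by blast+
  qed
  show ?thesis
  proof (intro exI[of _ \<mu>] conjI allI impI)
    fix A
    \<comment> \<open>Positivity comes from the upper bound 0 for the negated indicator.\<close>
    have "F (\<lambda>x. -1 * indicator A x) \<le> 0"
      by (rule F_le[OF bdd_scale[OF bdd_ind]]) simp
    then show "\<mu> A \<ge> 0" using F_scale[OF bdd_ind, of "-1" A] by (simp add: \<mu>_def)
  next
    fix A B :: "(nat \<Rightarrow> 'a) set" assume "A \<inter> B = {}"
    then have "indicator (A \<union> B) = (\<lambda>x. indicator A x + indicator B x :: real)"
      by (auto simp: fun_eq_iff indicator_def)
    then show "\<mu> (A \<union> B) = \<mu> A + \<mu> B" by (simp add: \<mu>_def F_add bdd_ind)
  next
    have "F (\<lambda>x. -1 * indicator UNIV x) \<le> -1"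
      by (rule F_le[OF bdd_scale[OF bdd_ind]]) simp
    moreover have "F (indicator UNIV) \<le> 1" by (rule F_le[OF bdd_ind]) simp
    ultimately show "\<mu> UNIV = 1"
      using F_scale[OF bdd_ind, of "-1" UNIV] by (simp add: \<mu>_def)
  next
    fix \<pi> A assume "\<pi> permutes {..<N}"
    then have "(\<lambda>x. x \<circ> \<pi>) \<in> G" by (auto simp: G_def)
    from F_inv[OF bdd_ind this, of A] show "\<mu> {x. x \<circ> \<pi> \<in> A} = \<mu> A"
      by (simp add: \<mu>_def indicator_def[abs_def])
  next
    fix V :: "nat \<Rightarrow> 'a set" assume V: "\<forall>i<n. V i \<in> S0"
    let ?g = "rect_ind n V"
    have g: "?g \<in> simple_rect_fun S0 n" using V[rule_format] by (rule rect_ind_in_simple_rect_fun)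
    have bdd_g: "bounded (range (\<lambda>x. ?g (\<lambda>i. x (\<sigma> i))))" for \<sigma>
      unfolding rect_ind_eq by (rule boundedI[of _ 1]) (auto simp: indicator_def)
    \<comment> \<open>\<open>?g\<close> sees only the first \<open>n\<close> coordinates, so
      \<open>\<sigma>\<close> may be replaced by a permutation extending it, under which
      \<open>F\<close> is invariant.\<close>
    have eq: "F (\<lambda>x. ?g (\<lambda>i. x (\<sigma> i))) = F ?g" if \<sigma>: "\<sigma> \<in> injs n N" for \<sigma>
    proof -
      obtain \<pi> where \<pi>: "\<pi> permutes {..<N}" "\<And>i. i < n \<Longrightarrow> \<pi> i = \<sigma> i"
        using extend_injection_to_permutation[OF \<sigma> nN] by blast
      have "(\<lambda>x. ?g (\<lambda>i. x (\<sigma> i))) = (\<lambda>x. ?g (x \<circ> \<pi>))"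
        by (rule ext, rule simple_rect_fun_cong[OF g]) (simp add: \<pi>(2))
      moreover have "(\<lambda>x. x \<circ> \<pi>) \<in> G" using \<pi>(1) by (auto simp: G_def)
      ultimately show ?thesis using F_inv[of ?g "\<lambda>x. x \<circ> \<pi>"] bdd_g[of id] by simp
    qed
    have "e ?g = F (U N n ?g)"
      using F_D DI[OF g] by auto
    also have "U N n ?g = (\<lambda>x. 1 / falling N n * (\<Sum>\<sigma>\<in>injs n N. ?g (\<lambda>i. x (\<sigma> i))))"
      by (simp add: fun_eq_iff U_def)
    also have "F \<dots> = 1 / falling N n * (\<Sum>\<sigma>\<in>injs n N. F (\<lambda>x. ?g (\<lambda>i. x (\<sigma> i))))"
      by (subst F_scale) (use F_sum[OF finite_injs[of n N] bdd_g] in simp_all)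
    also have "\<dots> = F ?g"
      using eq falling_pos[OF nN] by (simp add: card_injs)
    finally show "\<mu> {x. \<forall>i<n. x i \<in> V i} = e ?g"
      by (simp add: \<mu>_def rect_ind_eq[abs_def])
  qed
qed

subsection \<open>Countable additivity from compactness\<close>

text \<open>\<open>\<mu>\<close> is not controlled on the closed sets \<open>F\<close>, hence the sandwich \<open>B \<subseteq> F \<subseteq> A\<close>. The sets
  approximable in this way together with their complements form an algebra, so no description of
  the algebra generated by \<open>E\<close> is needed.\<close>

lemma finitely_additive_extension:
  fixes T :: "'c topology" and \<mu> :: "'c set \<Rightarrow> real" and E :: "'c set set"
  defines "\<Omega> \<equiv> topspace T"
  assumes nonneg: "\<And>A. \<mu> A \<ge> 0"
    and add: "\<And>A B. A \<inter> B = {} \<Longrightarrow> \<mu> (A \<union> B) = \<mu> A + \<mu> B"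
    and E: "E \<subseteq> Pow \<Omega>" "\<And>A. A \<in> E \<Longrightarrow> \<Omega> - A \<in> E"
    and approx: "\<And>A \<epsilon>. A \<in> E \<Longrightarrow> \<epsilon> > 0 \<Longrightarrow> \<exists>B F. closedin T F \<and> B \<subseteq> F \<and> F \<subseteq> A \<and> \<mu> (A - B) \<le> \<epsilon>"
    and tight: "\<And>\<epsilon>. \<epsilon> > 0 \<Longrightarrow> \<exists>B K. compactin T K \<and> B \<subseteq> K \<and> \<mu> (\<Omega> - B) \<le> \<epsilon>"
  shows "\<exists>Q. space Q = \<Omega> \<and> sets Q = sigma_sets \<Omega> E \<and>
    (\<forall>\<F>\<subseteq>E. finite \<F> \<longrightarrow> \<F> \<noteq> {} \<longrightarrow> emeasure Q (\<Inter>\<F>) = ennreal (\<mu> (\<Inter>\<F>)))"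
proof -
  have mono: "\<mu> A \<le> \<mu> B" if "A \<subseteq> B" for A B
    using add[of A "B - A"] nonneg[of "B - A"] that by (simp add: Un_absorb1)
  have subadd: "\<mu> (A \<union> B) \<le> \<mu> A + \<mu> B" for A B
    using add[of A "B - A"] mono[of "B - A" B] by simp
  have empty: "\<mu> {} = 0"
    using add[of "{}" "{}"] by simp
  define C where "C = {A. A \<subseteq> \<Omega> \<and> (\<forall>\<epsilon>>0. \<exists>B F. closedin T F \<and> B \<subseteq> F \<and> F \<subseteq> A \<and> \<mu> (A - B) \<le> \<epsilon>)}"
  \<comment> \<open>Both operations share one argument: \<open>op A A' - op B B'\<close> lies in
    \<open>(A - B) \<union> (A' - B')\<close>, and closed sets are stable under finite intersections
    and unions.\<close>
  have C_combine: "op A A' \<in> C"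
    if "A \<in> C" "A' \<in> C" and op: "op = (\<inter>) \<or> op = (\<union>)" for A A' op
  proof -
    have "\<exists>B F. closedin T F \<and> B \<subseteq> F \<and> F \<subseteq> op A A' \<and> \<mu> (op A A' - B) \<le> \<epsilon>" if "\<epsilon> > 0" for \<epsilon>
    proof -
      have "\<epsilon> / 2 > 0" using that by simp
      then obtain B F B' F' where
        1: "closedin T F" "B \<subseteq> F" "F \<subseteq> A" "\<mu> (A - B) \<le> \<epsilon> / 2" and
        2: "closedin T F'" "B' \<subseteq> F'" "F' \<subseteq> A'" "\<mu> (A' - B') \<le> \<epsilon> / 2"
        using \<open>A \<in> C\<close> \<open>A' \<in> C\<close> unfolding C_def by blast
      have "\<mu> (op A A' - op B B') \<le> \<mu> ((A - B) \<union> (A' - B'))"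
        by (rule mono) (use op in auto)
      also have "\<dots> \<le> \<epsilon>" using subadd[of "A - B" "A' - B'"] 1 2 by simp
      finally show ?thesis
        using 1 2 op by (intro exI[of _ "op B B'"] exI[of _ "op F F'"]) auto
    qed
    then show ?thesis using \<open>A \<in> C\<close> \<open>A' \<in> C\<close> op unfolding C_def by auto
  qed
  have triv: "{} \<in> C" "\<Omega> \<in> C"
    unfolding C_def \<Omega>_def using empty by (auto intro!: exI[of _ "{}"] exI[of _ "topspace T"])
  define \<A> where "\<A> = {A. A \<in> C \<and> \<Omega> - A \<in> C}"
  have \<A>sub: "\<A> \<subseteq> Pow \<Omega>" by (auto simp: \<A>_def C_def)
  have "a \<inter> b \<in> \<A>" if "a \<in> \<A>" "b \<in> \<A>" for a b
    using C_combine[of a b "(\<inter>)"] C_combine[of "\<Omega> - a" "\<Omega> - b" "(\<union>)"] that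
    by (simp add: \<A>_def Diff_Int)
  moreover have "\<Omega> - a \<in> \<A>" if "a \<in> \<A>" for a
    using that \<A>sub by (auto simp: \<A>_def double_diff)
  ultimately interpret algebra \<Omega> \<A>
    unfolding algebra_iff_Int using \<A>sub triv by (auto simp: \<A>_def)
  have "E \<subseteq> \<A>"
    using E approx by (auto simp: \<A>_def C_def)
  \<comment> \<open>Continuity at the empty set. Closed sets inside the \<open>A k\<close>, cut by a
    compact set, have empty intersection, hence already finitely many do; what remains of
    \<open>A m\<close> lies in the approximation errors.\<close>
  have small: "\<exists>m. \<mu> (A m) \<le> \<epsilon>"
    if A: "range A \<subseteq> \<A>" "decseq A" "(\<Inter>i. A i) = {}" and "\<epsilon> > 0" for A :: "nat \<Rightarrow> 'c set" and \<epsilon>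
  proof -
    \<comment> \<open>The errors form a geometric series of total \<open>\<epsilon> / 2\<close>; the
      other half is spent on leaving the compact set.\<close>
    have "\<exists>B F. closedin T F \<and> B \<subseteq> F \<and> F \<subseteq> A k \<and> \<mu> (A k - B) \<le> \<epsilon> / 2 * (1 / 2) ^ Suc k" for k
    proof -
      have "A k \<in> C" using A(1) by (auto simp: \<A>_def)
      moreover have "\<epsilon> / 2 * (1 / 2) ^ Suc k > 0" using \<open>\<epsilon> > 0\<close> by simp
      ultimately show ?thesis unfolding C_def by blast
    qed
    then obtain B F where BF: "\<And>k. closedin T (F k)" "\<And>k. B k \<subseteq> F k" "\<And>k. F k \<subseteq> A k"
      "\<And>k. \<mu> (A k - B k) \<le> \<epsilon> / 2 * (1 / 2) ^ Suc k"
      by metis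
    obtain K B0 where K: "compactin T K" "B0 \<subseteq> K" "\<mu> (\<Omega> - B0) \<le> \<epsilon> / 2"
      using tight[of "\<epsilon> / 2"] \<open>\<epsilon> > 0\<close> by auto
    have "K \<inter> \<Inter>(range F) = {}" using A(3) BF(3) by blast
    moreover have "\<forall>S\<in>range F. closedin T S" using BF(1) by blast
    ultimately obtain \<F> where \<F>: "finite \<F>" "\<F> \<subseteq> range F" "K \<inter> \<Inter>\<F> = {}"
      using K(1)[unfolded compactin_fip, THEN conjunct2, rule_format, of "range F"] by metis
    obtain J where J: "finite J" "\<F> = F ` J"
      using \<F>(1,2) by (meson finite_subset_image)
    obtain m where m: "J \<subseteq> {..m}"
      using J(1) unfolding finite_nat_set_iff_bounded_le by blast
    have bound: "\<mu> (\<Union>k\<le>m. A k - B k) \<le> \<epsilon> / 2 * (1 - (1 / 2) ^ Suc m)" for m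
    proof (induction m)
      case 0
      then show ?case using BF(4)[of 0] by simp
    next
      case (Suc m)
      have "(\<Union>k\<le>Suc m. A k - B k) = (A (Suc m) - B (Suc m)) \<union> (\<Union>k\<le>m. A k - B k)"
        by (simp add: atMost_Suc)
      then show ?case
        using subadd[of "A (Suc m) - B (Suc m)" "\<Union>k\<le>m. A k - B k"] Suc BF(4)[of "Suc m"]
        by (simp add: algebra_simps)
    qed
    \<comment> \<open>A point of \<open>A m\<close> lies in all earlier \<open>A k\<close>. Were it
      in \<open>B0\<close> and in every \<open>B k\<close>, it would belong to \<open>K\<close> and
      to all closed sets in \<open>\<F>\<close>, whose common intersection is empty.\<close>
    have "A m \<subseteq> (\<Omega> - B0) \<union> (\<Union>k\<le>m. A k - B k)"
    proof
      fix x assume x: "x \<in> A m"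
      then have xk: "x \<in> A k" if "k \<le> m" for k
        using A(2) that by (auto simp: decseq_def)
      have "x \<in> \<Omega>" using x A(1) \<A>sub by blast
      show "x \<in> (\<Omega> - B0) \<union> (\<Union>k\<le>m. A k - B k)"
      proof (rule ccontr)
        assume "x \<notin> (\<Omega> - B0) \<union> (\<Union>k\<le>m. A k - B k)"
        then have "x \<in> B0" "\<And>k. k \<le> m \<Longrightarrow> x \<in> B k" using xk \<open>x \<in> \<Omega>\<close> by auto
        then have "x \<in> K \<inter> \<Inter>\<F>" using K(2) BF(2) J m by blast
        with \<F>(3) show False by blast
      qed
    qed
    from mono[OF this] have "\<mu> (A m) \<le> \<mu> (\<Omega> - B0) + \<mu> (\<Union>k\<le>m. A k - B k)"
      using subadd[of "\<Omega> - B0" "\<Union>k\<le>m. A k - B k"] by simp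
    also have "\<dots> \<le> \<epsilon> / 2 + \<epsilon> / 2 * (1 - (1 / 2) ^ Suc m)"
      using K(3) bound[of m] by (rule add_mono)
    also have "\<dots> \<le> \<epsilon>" using \<open>\<epsilon> > 0\<close> by (simp add: algebra_simps)
    finally show ?thesis by blast
  qed
  have "\<exists>m. (\<forall>s\<in>\<A>. m s = ennreal (\<mu> s)) \<and> measure_space \<Omega> (sigma_sets \<Omega> \<A>) m"
  proof (rule caratheodory_empty_continuous)
    show "positive \<A> (\<lambda>A. ennreal (\<mu> A))" by (simp add: positive_def empty)
    show "additive \<A> (\<lambda>A. ennreal (\<mu> A))" by (simp add: additive_def add nonneg)
    show "ennreal (\<mu> A) \<noteq> \<infinity>" for A by simp
  next
    fix A :: "nat \<Rightarrow> 'c set" assume A: "range A \<subseteq> \<A>" "decseq A" "(\<Inter>i. A i) = {}"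
    have "(\<lambda>i. \<mu> (A i)) \<longlonglongrightarrow> 0"
    proof (rule LIMSEQ_I)
      fix r :: real assume "r > 0"
      then obtain m where m: "\<mu> (A m) \<le> r / 2" using small[OF A, of "r / 2"] by auto
      have "norm (\<mu> (A n) - 0) < r" if "n \<ge> m" for n
        using mono[of "A n" "A m"] A(2) that m nonneg[of "A n"] \<open>r > 0\<close> by (simp add: decseq_def)
      then show "\<exists>no. \<forall>n\<ge>no. norm (\<mu> (A n) - 0) < r" by blast
    qed
    then show "(\<lambda>i. ennreal (\<mu> (A i))) \<longlonglongrightarrow> 0"
      using tendsto_ennrealI by force
  qed
  then obtain m where m: "\<And>s. s \<in> \<A> \<Longrightarrow> m s = ennreal (\<mu> s)" "measure_space \<Omega> (sigma_sets \<Omega> \<A>) m"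
    by blast
  \<comment> \<open>\<open>\<A>\<close> may contain sets outside the sigma-algebra generated by
    \<open>E\<close>, so the measure is restricted to the latter.\<close>
  have ms: "measure_space \<Omega> (sigma_sets \<Omega> E) m"
    using m(2) sigma_algebra_sigma_sets[OF E(1)] sigma_sets_mono'[OF \<open>E \<subseteq> \<A>\<close>]
    by (rule measure_down)
  show ?thesis
  proof (intro exI conjI allI impI)
    show "space (measure_of \<Omega> E m) = \<Omega>" "sets (measure_of \<Omega> E m) = sigma_sets \<Omega> E"
      using E(1) by auto
    \<comment> \<open>The intersection of the empty family is \<open>UNIV\<close>, which may exceed
      \<open>\<Omega>\<close>; hence the nonemptiness.\<close>
    fix \<F> assume \<F>: "\<F> \<subseteq> E" "finite \<F>" "\<F> \<noteq> {}"
    have in_E: "\<Inter>\<F> \<in> sigma_sets \<Omega> E"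
    proof -
      interpret S: sigma_algebra \<Omega> "sigma_sets \<Omega> E" by (rule sigma_algebra_sigma_sets[OF E(1)])
      show ?thesis using \<F> S.finite_INT[of \<F> "\<lambda>x. x"] by (auto intro: sigma_sets.Basic)
    qed
    have "\<Inter>\<F> \<in> \<A>"
      using \<F> \<open>E \<subseteq> \<A>\<close> finite_INT[of \<F> "\<lambda>x. x"] by auto
    then show "emeasure (measure_of \<Omega> E m) (\<Inter>\<F>) = ennreal (\<mu> (\<Inter>\<F>))"
      using emeasure_measure_of_conv[of \<Omega> E m] ms in_E m(1) by simp
  qed
qed

subsection \<open>Extendibility\<close>

text \<open>The family \<open>J\<close> selects the generator: singletons give the one-coordinate
  cylinders used to construct a measure, the whole index set gives the rectangles used for
  uniqueness.\<close>

lemma sets_PiM_borel_generated: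
  fixes S0 :: "'a::topological_space set set" and J :: "nat set set"
  assumes gen: "sigma_sets UNIV S0 = sets (borel :: 'a measure)" and UNIV: "UNIV \<in> S0"
    and J: "\<And>j. j \<in> J \<Longrightarrow> finite j" "\<Union>J = {..<m}"
  shows "sets (prodS m :: (nat \<Rightarrow> 'a) measure) = sigma_sets ({..<m} \<rightarrow>\<^sub>E UNIV)
    {{x \<in> {..<m} \<rightarrow>\<^sub>E UNIV. \<forall>i\<in>j. x i \<in> V i} | V j. j \<in> J \<and> V \<in> j \<rightarrow> S0}"
    (is "_ = sigma_sets ?\<Omega> ?P")
proof -
  have "sets (prodS m :: (nat \<Rightarrow> 'a) measure) = sets (\<Pi>\<^sub>M i\<in>{..<m}. sigma UNIV S0)"
    by (intro sets_PiM_cong refl) (simp add: gen)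
  also have "\<dots> = sets (sigma ?\<Omega> ?P)"
    by (rule sets_PiM_sigma) (use UNIV J in \<open>auto intro!: exI[of _ "{UNIV}"]\<close>)
  also have "\<dots> = sigma_sets ?\<Omega> ?P"
    by (rule sets_measure_of) auto
  finally show ?thesis .
qed

text \<open>Rectangles with sides in the algebra \<open>S0\<close> are closed under intersection,
  generate the product sigma-algebra and include the whole space, which has finite mass.\<close>

lemma measure_eqI_prodS:
  fixes S0 :: "'a::topological_space set set"
  assumes alg: "algebra UNIV S0" and gen: "sigma_sets UNIV S0 = sets (borel :: 'a measure)"
    and P: "finite_measure P" "sets P = sets (prodS m)" and Q: "sets Q = sets (prodS m)"
    and eq: "\<And>V. (\<And>i. i < m \<Longrightarrow> V i \<in> S0) \<Longrightarrow> emeasure P (Pi\<^sub>E {..<m} V) = emeasure Q (Pi\<^sub>E {..<m} V)"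
  shows "P = Q"
proof -
  interpret S0: algebra UNIV S0 by fact
  let ?E = "{{x \<in> {..<m} \<rightarrow>\<^sub>E UNIV. \<forall>i\<in>j. x i \<in> V i} | V j. j \<in> {{..<m}} \<and> V \<in> j \<rightarrow> S0}"
  have E: "?E = {Pi\<^sub>E {..<m} V | V. V \<in> {..<m} \<rightarrow> S0}" (is "_ = ?R")
    by (auto simp: PiE_def Pi_def)
  have sets: "sets (prodS m :: (nat \<Rightarrow> 'a) measure) = sigma_sets ({..<m} \<rightarrow>\<^sub>E UNIV) ?R"
    using sets_PiM_borel_generated[OF gen S0.top, of "{{..<m}}" m] unfolding E by simp
  show ?thesis
  proof (rule measure_eqI_generator_eq[where A = "\<lambda>_. {..<m} \<rightarrow>\<^sub>E UNIV"])
    show "Int_stable ?R"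
    proof (rule Int_stableI)
      fix a b assume "a \<in> ?R" "b \<in> ?R"
      then obtain V W where "a = Pi\<^sub>E {..<m} V" "b = Pi\<^sub>E {..<m} W" "V \<in> {..<m} \<rightarrow> S0" "W \<in> {..<m} \<rightarrow> S0"
        by blast
      then have "a \<inter> b = Pi\<^sub>E {..<m} (\<lambda>i. V i \<inter> W i)" "(\<lambda>i. V i \<inter> W i) \<in> {..<m} \<rightarrow> S0"
        by (auto simp: PiE_Int)
      then show "a \<inter> b \<in> ?R" by blast
    qed
    show "?R \<subseteq> Pow ({..<m} \<rightarrow>\<^sub>E UNIV)" by (auto simp: PiE_def)
    show "emeasure P X = emeasure Q X" if "X \<in> ?R" for X
      using that eq by auto
    show "range (\<lambda>_. {..<m} \<rightarrow>\<^sub>E UNIV) \<subseteq> ?R" using S0.top by auto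
    show "emeasure P ({..<m} \<rightarrow>\<^sub>E UNIV) \<noteq> \<infinity>"
      using finite_measure.emeasure_finite[OF P(1)] by simp
  qed (use P(2) Q sets in auto)
qed

lemma simple_rect_fun_measurable:
  fixes S0 :: "'a::topological_space set set"
  assumes "g \<in> simple_rect_fun S0 n" "S0 \<subseteq> sets borel" "n \<le> m"
  shows "g \<in> borel_measurable (prodS m)"
proof -
  obtain k :: nat and c V where g: "\<forall>j<k. \<forall>i<n. V j i \<in> S0" "g = (\<lambda>x. \<Sum>j<k. c j * rect_ind n (V j) x)"
    using assms(1) unfolding simple_rect_fun_iff by blast
  have "(\<lambda>x. indicator (V j i) (x i) :: real) \<in> borel_measurable (prodS m)" if "j < k" "i < n" for i j
    using g(1) assms(2,3) that
    by (intro measurable_compose[OF measurable_component_singleton[of i] borel_measurable_indicator]) auto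
  then show ?thesis
    unfolding g(2) rect_ind_def
    by (intro borel_measurable_sum borel_measurable_times borel_measurable_const borel_measurable_prod) auto
qed

text \<open>A real supremum is informative only for a bounded set; \<open>c\<close> supplies that
  bound.\<close>

lemma supnorm_upper:
  assumes "\<And>x. \<bar>h x\<bar> \<le> c"
  shows "\<bar>h x\<bar> \<le> supnorm h"
  unfolding supnorm_def by (intro cSUP_upper bdd_aboveI2[where M = c] assms UNIV_I)

section \<open>Necessity: expectations under an exchangeable extension\<close>

lemma extendible_expectation_bound:
  fixes X :: "'b \<Rightarrow> nat \<Rightarrow> 'a::topological_space"
  assumes "extendible M n X N" "X \<in> M \<rightarrow>\<^sub>M prodS n"
    and g: "g \<in> simple_rect_fun S0 n" and S0: "S0 \<subseteq> sets borel"
  shows "\<bar>integral\<^sup>L M (\<lambda>\<omega>. g (X \<omega>))\<bar> \<le> supnorm (U N n g)"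
proof -
  obtain Q :: "(nat \<Rightarrow> 'a) measure" and Y where nN: "n \<le> N" and Q: "prob_space Q"
    and Y: "exchangeable Q N Y"
    and law: "distr Q (prodS n) (\<lambda>\<omega>. restrict (Y \<omega>) {..<n}) = distr M (prodS n) X"
    using assms(1) unfolding extendible_def by blast
  interpret Q: prob_space Q by fact
  have Ym: "Y \<in> Q \<rightarrow>\<^sub>M prodS N" using Y by (simp add: exchangeable_def)
  have Yr: "(\<lambda>\<omega>. restrict (\<lambda>i. Y \<omega> (\<pi> i)) {..<m}) \<in> Q \<rightarrow>\<^sub>M prodS m" if "\<And>i. i < m \<Longrightarrow> \<pi> i < N" for m \<pi>
    using that by (intro measurable_restrict measurable_compose[OF Ym] measurable_component_singleton) auto
  have gm: "g \<in> borel_measurable (prodS n)" "g \<in> borel_measurable (prodS N)"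
    using simple_rect_fun_measurable[OF g S0] nN by auto
  obtain c where c: "\<And>x. \<bar>g x\<bar> \<le> c" using simple_rect_fun_bounded[OF g] by blast
  have Eg: "(\<integral>\<omega>. g (X \<omega>) \<partial>M) = (\<integral>\<omega>. g (Y \<omega>) \<partial>Q)"
  proof -
    have "(\<integral>\<omega>. g (X \<omega>) \<partial>M) = (\<integral>x. g x \<partial>distr M (prodS n) X)"
      using assms(2) gm(1) by (simp add: integral_distr)
    also have "\<dots> = (\<integral>\<omega>. g (restrict (Y \<omega>) {..<n}) \<partial>Q)"
      unfolding law[symmetric] using Yr[of n id] nN gm(1) by (simp add: integral_distr)
    also have "\<dots> = (\<integral>\<omega>. g (Y \<omega>) \<partial>Q)"
      by (intro Bochner_Integration.integral_cong refl simple_rect_fun_cong[OF g]) simp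
    finally show ?thesis .
  qed
  have Uc: "\<bar>U N n g x\<bar> \<le> c" for x by (rule abs_U_le[OF nN c])
  have "integrable Q (\<lambda>\<omega>. g (\<lambda>i. Y \<omega> (\<sigma> i))) \<and> (\<integral>\<omega>. g (\<lambda>i. Y \<omega> (\<sigma> i)) \<partial>Q) = (\<integral>\<omega>. g (Y \<omega>) \<partial>Q)"
    if \<sigma>: "\<sigma> \<in> injs n N" for \<sigma>
  proof -
    obtain \<pi> where \<pi>: "\<pi> permutes {..<N}" "\<And>i. i < n \<Longrightarrow> \<pi> i = \<sigma> i"
      using extend_injection_to_permutation[OF \<sigma> nN] by blast
    \<comment> \<open>\<open>Z\<close> is a full coordinate permutation of \<open>Y\<close>, so
      exchangeability gives it the law of \<open>Y\<close>, while its first \<open>n\<close>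
      coordinates are those selected by \<open>\<sigma>\<close>.\<close>
    define Z where "Z = (\<lambda>\<omega>. restrict (\<lambda>i. Y \<omega> (\<pi> i)) {..<N})"
    have Zm: "Z \<in> Q \<rightarrow>\<^sub>M prodS N"
      unfolding Z_def by (rule Yr) (use permutes_in_image[OF \<pi>(1)] in auto)
    have gZ: "(\<lambda>\<omega>. g (\<lambda>i. Y \<omega> (\<sigma> i))) = (\<lambda>\<omega>. g (Z \<omega>))"
      unfolding Z_def by (rule ext, rule simple_rect_fun_cong[OF g]) (use nN in \<open>simp add: \<pi>(2)\<close>)
    have "(\<integral>\<omega>. g (Z \<omega>) \<partial>Q) = (\<integral>x. g x \<partial>distr Q (prodS N) Z)"
      using Zm gm(2) by (simp add: integral_distr)
    also have "distr Q (prodS N) Z = distr Q (prodS N) Y"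
      using Y \<pi>(1) unfolding exchangeable_def Z_def by blast
    also have "(\<integral>x. g x \<partial>\<dots>) = (\<integral>\<omega>. g (Y \<omega>) \<partial>Q)"
      using Ym gm(2) by (simp add: integral_distr)
    finally show ?thesis
      unfolding gZ using c measurable_compose[OF Zm gm(2)]
      by (auto intro!: Q.integrable_const_bound[of _ c])
  qed
  then have int: "integrable Q (\<lambda>\<omega>. U N n g (Y \<omega>))"
    and "(\<integral>\<omega>. U N n g (Y \<omega>) \<partial>Q) = (\<integral>\<omega>. g (Y \<omega>) \<partial>Q)"
    using falling_pos[OF nN] by (simp_all add: U_def card_injs)
  then have "\<bar>\<integral>\<omega>. g (X \<omega>) \<partial>M\<bar> = \<bar>\<integral>\<omega>. U N n g (Y \<omega>) \<partial>Q\<bar>" using Eg by simp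
  also have "\<dots> \<le> (\<integral>\<omega>. \<bar>U N n g (Y \<omega>)\<bar> \<partial>Q)" by (rule integral_abs_bound)
  also have "\<dots> \<le> supnorm (U N n g)"
    using int supnorm_upper[of "U N n g" c, OF Uc] by (intro Q.integral_le_const) auto
  finally show ?thesis .
qed

section \<open>Sufficiency: from a finitely additive probability to an exchangeable law\<close>

text \<open>By invariance every single coordinate has, on \<open>S0\<close>, the distribution of the
  first coordinate of \<open>X\<close>, so \<open>tight\<close> and \<open>regular\<close> control
  all cylinders. The resulting measure agrees with \<open>\<nu>\<close> on rectangles, and
  rectangles determine both exchangeability and the marginal law.\<close>

lemma charge_imp_extendible:
  fixes X :: "'b \<Rightarrow> nat \<Rightarrow> 'a::topological_space" and \<nu> :: "(nat \<Rightarrow> 'a) set \<Rightarrow> real"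
  assumes alg: "algebra UNIV S0"
    and gen: "sigma_sets UNIV S0 = sets (borel :: 'a measure)"
    and M: "prob_space M" and X: "X \<in> M \<rightarrow>\<^sub>M prodS n" and n: "n \<ge> 1" "n \<le> N"
    and tight: "\<And>\<epsilon>::real. \<epsilon> > 0 \<Longrightarrow> \<exists>V\<in>S0. \<exists>K. compact K \<and> V \<subseteq> K \<and>
        measure M {\<omega>\<in>space M. X \<omega> 0 \<in> V} \<ge> 1 - \<epsilon>"
    and regular: "\<And>(\<epsilon>::real) V. \<epsilon> > 0 \<Longrightarrow> V \<in> S0 \<Longrightarrow> \<exists>G W. open G \<and> W \<in> S0 \<and>
        V \<subseteq> G \<and> G \<subseteq> W \<and> measure M {\<omega>\<in>space M. X \<omega> 0 \<in> W - V} \<le> \<epsilon>"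
    and nonneg: "\<And>A. \<nu> A \<ge> 0"
    and add: "\<And>A B. A \<inter> B = {} \<Longrightarrow> \<nu> (A \<union> B) = \<nu> A + \<nu> B"
    and total: "\<nu> UNIV = 1"
    and inv: "\<And>\<pi> A. \<pi> permutes {..<N} \<Longrightarrow> \<nu> {x. x \<circ> \<pi> \<in> A} = \<nu> A"
    and marginal: "\<And>V. (\<And>i. i < n \<Longrightarrow> V i \<in> S0) \<Longrightarrow>
        \<nu> {x. \<forall>i<n. x i \<in> V i} = measure M {\<omega>\<in>space M. \<forall>i<n. X \<omega> i \<in> V i}"
  shows "extendible M n X N"
proof -
  interpret M: prob_space M by fact
  interpret S0: algebra UNIV S0 by fact
  have S0_borel: "V \<in> sets borel" if "V \<in> S0" for V
    using that gen by auto
  have mono: "\<nu> A \<le> \<nu> B" if "A \<subseteq> B" for A B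
    using add[of A "B - A"] nonneg[of "B - A"] that by (simp add: Un_absorb1)
  have subadd: "\<nu> (\<Union>i<k. A i) \<le> (\<Sum>i<k. \<nu> (A i))" for A and k :: nat
  proof (induction k)
    case 0
    then show ?case using add[of "{}" "{}"] by simp
  next
    case (Suc k)
    have "(\<Union>i<Suc k. A i) = (\<Union>i<k. A i) \<union> (A k - (\<Union>i<k. A i))"
      by (auto simp: lessThan_Suc)
    then have "\<nu> (\<Union>i<Suc k. A i) = \<nu> (\<Union>i<k. A i) + \<nu> (A k - (\<Union>i<k. A i))"
      using add[of "\<Union>i<k. A i" "A k - (\<Union>i<k. A i)"] by auto
    also have "\<nu> (A k - (\<Union>i<k. A i)) \<le> \<nu> (A k)" by (rule mono) auto
    finally show ?case using Suc by simp
  qed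
  have coord: "\<nu> {x. x i \<in> V} = measure M {\<omega>\<in>space M. X \<omega> 0 \<in> V}" if "i < N" "V \<in> S0" for i V
  proof -
    \<comment> \<open>A transposition moves coordinate \<open>i\<close> to 0; the event there is a
      rectangle whose other sides are \<open>UNIV\<close>, so \<open>marginal\<close>
      applies.\<close>
    have "Transposition.transpose 0 i permutes {..<N}"
      by (rule permutes_swap_id) (use n \<open>i < N\<close> in auto)
    from inv[OF this, of "{x. x 0 \<in> V}"] have "\<nu> {x. x i \<in> V} = \<nu> {x. x 0 \<in> V}" by simp
    also have "\<dots> = \<nu> {x. \<forall>j<n. x j \<in> (if j = 0 then V else UNIV)}"
      using n(1) by (intro arg_cong[of _ _ \<nu>]) (auto split: if_splits)
    also have "\<dots> = measure M {\<omega>\<in>space M. \<forall>j<n. X \<omega> j \<in> (if j = 0 then V else UNIV)}"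
      using \<open>V \<in> S0\<close> S0.top by (intro marginal) auto
    also have "\<dots> = measure M {\<omega>\<in>space M. X \<omega> 0 \<in> V}"
      using n(1) by (intro arg_cong[of _ _ "measure M"]) (auto split: if_splits)
    finally show ?thesis .
  qed
  define \<Omega> :: "(nat \<Rightarrow> 'a) set" where "\<Omega> = {..<N} \<rightarrow>\<^sub>E UNIV"
  define T :: "(nat \<Rightarrow> 'a) topology" where "T = product_topology (\<lambda>_. euclidean) {..<N}"
  have T: "topspace T = \<Omega>" by (simp add: T_def \<Omega>_def)
  define cyl where "cyl i V = {x \<in> \<Omega>. x i \<in> V}" for i :: nat and V :: "'a set"
  define E where "E = {cyl i V | i V. i < N \<and> V \<in> S0}"
  \<comment> \<open>\<open>\<nu>\<close> lives on all functions on \<open>nat\<close>, while the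
    product space contains only functions extensional on \<open>{..<N}\<close>; \<open>\<mu>\<close>
    is the image of \<open>\<nu>\<close> under restriction.\<close>
  define \<mu> where "\<mu> A = \<nu> {x. restrict x {..<N} \<in> A}" for A
  have rect_eq: "{x \<in> \<Omega>. \<forall>i<N. x i \<in> V i} = Pi\<^sub>E {..<N} V" for V
    by (simp add: \<Omega>_def PiE_def Pi_def set_eq_iff conj_commute)
  have restrict_\<Omega>: "restrict x {..<N} \<in> \<Omega>" for x :: "nat \<Rightarrow> 'a" by (simp add: \<Omega>_def)
  have \<mu>_cyl: "\<mu> (cyl i V) = measure M {\<omega>\<in>space M. X \<omega> 0 \<in> V}" if "i < N" "V \<in> S0" for i V
    unfolding \<mu>_def cyl_def using coord[OF that] that(1) restrict_\<Omega> by simp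
  have sets_E: "sets (prodS N :: (nat \<Rightarrow> 'a) measure) = sigma_sets \<Omega> E"
  proof -
    have "{{x \<in> {..<N} \<rightarrow>\<^sub>E UNIV. \<forall>i\<in>j. x i \<in> V i} | V j. j \<in> (\<lambda>i. {i}) ` {..<N} \<and> V \<in> j \<rightarrow> S0} = E"
    proof (intro set_eqI iffI)
      fix A assume "A \<in> E"
      then obtain i V where "A = cyl i V" "i < N" "V \<in> S0" by (auto simp: E_def)
      then show "A \<in> {{x \<in> {..<N} \<rightarrow>\<^sub>E UNIV. \<forall>i\<in>j. x i \<in> V i} | V j. j \<in> (\<lambda>i. {i}) ` {..<N} \<and> V \<in> j \<rightarrow> S0}"
        unfolding cyl_def \<Omega>_def
        by (intro CollectI exI[of _ "\<lambda>_. V"] exI[of _ "{i}"]) auto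
    qed (auto simp: E_def cyl_def \<Omega>_def)
    then show ?thesis
      using sets_PiM_borel_generated[OF gen S0.top, of "(\<lambda>i. {i}) ` {..<N}" N] by (auto simp: \<Omega>_def)
  qed
  have "\<exists>Q. space Q = \<Omega> \<and> sets Q = sigma_sets \<Omega> E \<and>
    (\<forall>\<F>\<subseteq>E. finite \<F> \<longrightarrow> \<F> \<noteq> {} \<longrightarrow> emeasure Q (\<Inter>\<F>) = ennreal (\<mu> (\<Inter>\<F>)))"
  proof (rule finitely_additive_extension[of \<mu> E T, unfolded T])
    show "\<mu> A \<ge> 0" for A by (simp add: \<mu>_def nonneg)
    show "\<mu> (A \<union> B) = \<mu> A + \<mu> B" if "A \<inter> B = {}" for A B
    proof -
      have "{x. restrict x {..<N} \<in> A \<union> B} = {x. restrict x {..<N} \<in> A} \<union> {x. restrict x {..<N} \<in> B}"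
        by auto
      then show ?thesis unfolding \<mu>_def using that by (simp only:) (intro add, auto)
    qed
    show "E \<subseteq> Pow \<Omega>" by (auto simp: E_def cyl_def)
    show "\<Omega> - A \<in> E" if A: "A \<in> E" for A
    proof -
      obtain i V where "A = cyl i V" "i < N" "V \<in> S0" using A by (auto simp: E_def)
      moreover from this have "\<Omega> - A = cyl i (UNIV - V)" by (auto simp: cyl_def)
      ultimately show ?thesis unfolding E_def using S0.compl_sets by blast
    qed
    show "\<exists>B F. closedin T F \<and> B \<subseteq> F \<and> F \<subseteq> A \<and> \<mu> (A - B) \<le> \<epsilon>" if A: "A \<in> E" and "\<epsilon> > 0" for A \<epsilon>
    proof -
      obtain i V where i: "A = cyl i V" "i < N" "V \<in> S0" using A by (auto simp: E_def)
      have "UNIV - V \<in> S0" using i(3) by (rule S0.compl_sets)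
      \<comment> \<open>Outer approximation of the complement is inner approximation of
        \<open>V\<close>: \<open>- W \<subseteq> - G \<subseteq> V\<close> with \<open>- G\<close>
        closed, and the loss \<open>V - (- W)\<close> equals \<open>W - (UNIV - V)\<close>.\<close>
      from regular[OF \<open>\<epsilon> > 0\<close> this] obtain G W where GW: "open G" "W \<in> S0" "UNIV - V \<subseteq> G" "G \<subseteq> W"
        "measure M {\<omega>\<in>space M. X \<omega> 0 \<in> W - (UNIV - V)} \<le> \<epsilon>" by blast
      have "closedin T {x \<in> topspace T. x i \<in> - G}"
        unfolding T_def
      proof (rule closedin_continuous_map_preimage)
        show "continuous_map (product_topology (\<lambda>_. euclidean) {..<N}) euclidean (\<lambda>x. x i)"
          using i(2) by (intro continuous_map_product_projection) auto
      qed (use GW(1) in \<open>simp add: closed_Compl\<close>)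
      then have "closedin T (cyl i (- G))" by (simp add: T cyl_def)
      moreover have "cyl i (- W) \<subseteq> cyl i (- G)" "cyl i (- G) \<subseteq> A"
        using GW i(1) by (auto simp: cyl_def)
      moreover have "A - cyl i (- W) = cyl i (W - (UNIV - V))"
        using i(1) by (auto simp: cyl_def)
      then have "\<mu> (A - cyl i (- W)) \<le> \<epsilon>"
        using \<mu>_cyl[OF i(2) S0.Diff[OF GW(2) S0.compl_sets[OF i(3)]]] GW(5) by simp
      ultimately show ?thesis by blast
    qed
    show "\<exists>B K. compactin T K \<and> B \<subseteq> K \<and> \<mu> (\<Omega> - B) \<le> \<epsilon>" if "\<epsilon> > 0" for \<epsilon>
    proof -
      \<comment> \<open>Each of the \<open>N\<close> coordinates may leave \<open>V\<close> with
        mass at most \<open>\<epsilon> / N\<close>; a union bound then controls the complement of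
        the power of \<open>V\<close>.\<close>
      have "\<epsilon> / N > 0" using that n by simp
      then obtain V K where V: "V \<in> S0" "compact K" "V \<subseteq> K"
        "measure M {\<omega>\<in>space M. X \<omega> 0 \<in> V} \<ge> 1 - \<epsilon> / N"
        using tight by blast
      have small: "\<nu> {x. x i \<notin> V} \<le> \<epsilon> / N" if "i < N" for i
      proof -
        have "{x. x i \<in> V} \<inter> {x. x i \<notin> V} = {}" "{x. x i \<in> V} \<union> {x. x i \<notin> V} = UNIV"
          by auto
        then have "\<nu> {x. x i \<in> V} + \<nu> {x. x i \<notin> V} = 1"
          using add[of "{x. x i \<in> V}" "{x. x i \<notin> V}"] total by simp
        then show ?thesis using coord[OF that V(1)] V(4) by linarith
      qed
      have "compactin T ({..<N} \<rightarrow>\<^sub>E K)"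
        unfolding T_def compactin_PiE using V(2) by simp
      moreover have "({..<N} \<rightarrow>\<^sub>E V) \<subseteq> ({..<N} \<rightarrow>\<^sub>E K)"
        using V(3) by (intro PiE_mono) auto
      moreover have "\<mu> (\<Omega> - ({..<N} \<rightarrow>\<^sub>E V)) \<le> \<nu> (\<Union>i<N. {x. x i \<notin> V})"
        unfolding \<mu>_def by (rule mono) auto
      moreover note subadd[of "\<lambda>i. {x. x i \<notin> V}" N]
      moreover have "(\<Sum>i<N. \<nu> {x. x i \<notin> V}) \<le> (\<Sum>i<N. \<epsilon> / N)"
        by (rule sum_mono) (use small in auto)
      ultimately show ?thesis
        using n by (intro exI[of _ "{..<N} \<rightarrow>\<^sub>E V"] exI[of _ "{..<N} \<rightarrow>\<^sub>E K"]) auto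
    qed
  qed
  then obtain Q where Q: "space Q = \<Omega>" "sets Q = sigma_sets \<Omega> E"
    "\<And>\<F>. \<F> \<subseteq> E \<Longrightarrow> finite \<F> \<Longrightarrow> \<F> \<noteq> {} \<Longrightarrow> emeasure Q (\<Inter>\<F>) = ennreal (\<mu> (\<Inter>\<F>))"
    by blast
  have Q_rect: "emeasure Q (Pi\<^sub>E {..<N} V) = ennreal (\<nu> {x. \<forall>i<N. x i \<in> V i})"
    if "\<And>i. i < N \<Longrightarrow> V i \<in> S0" for V
  proof -
    let ?\<F> = "(\<lambda>i. cyl i (V i)) ` {..<N}"
    have "0 \<in> {..<N}" using n by simp
    then have "?\<F> \<noteq> {}" by blast
    moreover have "?\<F> \<subseteq> E" using that by (auto simp: E_def)
    ultimately have "emeasure Q (\<Inter>?\<F>) = ennreal (\<mu> (\<Inter>?\<F>))"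
      by (intro Q(3)) auto
    moreover have "\<Inter>?\<F> = {x \<in> \<Omega>. \<forall>i<N. x i \<in> V i}"
      using \<open>0 \<in> {..<N}\<close> unfolding cyl_def by blast
    then have "\<Inter>?\<F> = Pi\<^sub>E {..<N} V"
      unfolding rect_eq .
    moreover have "{x. restrict x {..<N} \<in> Pi\<^sub>E {..<N} V} = {x. \<forall>i<N. x i \<in> V i}"
      by auto
    ultimately show ?thesis by (simp add: \<mu>_def)
  qed
  have sets_Q: "sets Q = sets (prodS N)" using Q(2) sets_E by simp
  have Q_prob: "prob_space Q"
  proof
    show "emeasure Q (space Q) = 1"
      using Q_rect[of "\<lambda>_. UNIV"] S0.top total Q(1) by (simp add: \<Omega>_def)
  qed
  interpret Q: prob_space Q by fact
  have Q_event: "emeasure Q {x \<in> \<Omega>. \<forall>i<N. x i \<in> V i} = ennreal (\<nu> {x. \<forall>i<N. x i \<in> V i})"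
    if "\<And>i. i < N \<Longrightarrow> V i \<in> S0" for V
    unfolding rect_eq by (rule Q_rect[OF that])
  have restrict_measurable: "(\<lambda>\<omega>. restrict (\<lambda>i. \<omega> (\<pi> i)) {..<m}) \<in> Q \<rightarrow>\<^sub>M prodS m"
    if "\<And>i. i < m \<Longrightarrow> \<pi> i < N" for m \<pi>
  proof -
    have "(\<lambda>\<omega>. restrict (\<lambda>i. \<omega> (\<pi> i)) {..<m}) \<in> prodS N \<rightarrow>\<^sub>M (prodS m :: (nat \<Rightarrow> 'a) measure)"
      using that by (intro measurable_restrict measurable_component_singleton) auto
    then show ?thesis by (simp cong: measurable_cong_sets add: sets_Q)
  qed
  have rect_sets: "Pi\<^sub>E {..<m} V \<in> sets (prodS m)" if "\<And>i. i < m \<Longrightarrow> V i \<in> S0" for m V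
    using that S0_borel by (intro sets_PiM_I_finite) auto
  have exch: "exchangeable Q N (\<lambda>\<omega>. \<omega>)"
    unfolding exchangeable_def
  proof (intro conjI allI impI)
    show id: "(\<lambda>\<omega>. \<omega>) \<in> Q \<rightarrow>\<^sub>M prodS N" using measurable_ident_sets[OF sets_Q] .
    fix \<pi> assume \<pi>: "\<pi> permutes {..<N}"
    have \<pi>N: "\<pi> i < N \<longleftrightarrow> i < N" for i using permutes_in_image[OF \<pi>, of i] by simp
    let ?Y = "\<lambda>\<omega>. restrict (\<lambda>i. \<omega> (\<pi> i)) {..<N}"
    have Ym: "?Y \<in> Q \<rightarrow>\<^sub>M prodS N" by (rule restrict_measurable) (simp add: \<pi>N)
    show "distr Q (prodS N) ?Y = distr Q (prodS N) (\<lambda>\<omega>. \<omega>)"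
    proof (rule measure_eqI_prodS[OF alg gen])
      show "finite_measure (distr Q (prodS N) ?Y)"
        using Q.prob_space_distr[OF Ym] by (simp add: prob_space_def)
      fix V :: "nat \<Rightarrow> 'a set" assume V: "\<And>i. i < N \<Longrightarrow> V i \<in> S0"
      have inv\<pi>N: "inv \<pi> i < N \<longleftrightarrow> i < N" for i
        using permutes_in_image[OF permutes_inv[OF \<pi>], of i] by simp
      \<comment> \<open>Permuting the coordinates of a point amounts to permuting the sides of the
        rectangle by the inverse.\<close>
      have swap: "(\<forall>i<N. x (\<pi> i) \<in> V i) \<longleftrightarrow> (\<forall>i<N. x i \<in> V (inv \<pi> i))" for x
        using \<pi>N inv\<pi>N permutes_inverses[OF \<pi>] by metis
      have "?Y -` Pi\<^sub>E {..<N} V \<inter> space Q = {x \<in> \<Omega>. \<forall>i<N. x (\<pi> i) \<in> V i}"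
        by (simp add: Q(1) set_eq_iff conj_commute Pi_def)
      then have "emeasure (distr Q (prodS N) ?Y) (Pi\<^sub>E {..<N} V) = emeasure Q {x \<in> \<Omega>. \<forall>i<N. x (\<pi> i) \<in> V i}"
        using emeasure_distr[OF Ym rect_sets[OF V]] by simp
      also have "\<dots> = ennreal (\<nu> {x. \<forall>i<N. x (\<pi> i) \<in> V i})"
        unfolding swap by (rule Q_event) (simp add: V inv\<pi>N)
      also have "\<nu> {x. \<forall>i<N. x (\<pi> i) \<in> V i} = \<nu> {x. \<forall>i<N. x i \<in> V i}"
        using inv[OF \<pi>, of "{x. \<forall>i<N. x i \<in> V i}"] by simp
      also have "ennreal \<dots> = emeasure (distr Q (prodS N) (\<lambda>\<omega>. \<omega>)) (Pi\<^sub>E {..<N} V)"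
        using emeasure_distr[OF id rect_sets[OF V]] Q_rect[OF V] sets.sets_into_space[OF rect_sets[OF V]]
        by (simp add: Q(1) \<Omega>_def space_PiM Int_absorb2)
      finally show "emeasure (distr Q (prodS N) ?Y) (Pi\<^sub>E {..<N} V) =
          emeasure (distr Q (prodS N) (\<lambda>\<omega>. \<omega>)) (Pi\<^sub>E {..<N} V)" .
    qed simp_all
  qed
  have law: "distr Q (prodS n) (\<lambda>\<omega>. restrict \<omega> {..<n}) = distr M (prodS n) X"
  proof (rule measure_eqI_prodS[OF alg gen])
    have rm: "(\<lambda>\<omega>. restrict \<omega> {..<n}) \<in> Q \<rightarrow>\<^sub>M prodS n"
      using restrict_measurable[of n id] n by simp
    show "finite_measure (distr Q (prodS n) (\<lambda>\<omega>. restrict \<omega> {..<n}))"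
      using Q.prob_space_distr[OF rm] by (simp add: prob_space_def)
    fix V :: "nat \<Rightarrow> 'a set" assume V: "\<And>i. i < n \<Longrightarrow> V i \<in> S0"
    \<comment> \<open>Padding with \<open>UNIV\<close> makes the event on the first \<open>n\<close>
      coordinates a rectangle in all \<open>N\<close> coordinates.\<close>
    define V' where "V' i = (if i < n then V i else UNIV)" for i
    have V'_iff: "(\<forall>i<N. x i \<in> V' i) \<longleftrightarrow> (\<forall>i<n. x i \<in> V i)" for x
      using n(2) by (auto simp: V'_def)
    have "(\<lambda>\<omega>. restrict \<omega> {..<n}) -` Pi\<^sub>E {..<n} V \<inter> space Q = {x \<in> \<Omega>. \<forall>i<N. x i \<in> V' i}"
      unfolding V'_iff by (simp add: Q(1) set_eq_iff conj_commute Pi_def)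
    then have "emeasure (distr Q (prodS n) (\<lambda>\<omega>. restrict \<omega> {..<n})) (Pi\<^sub>E {..<n} V) =
        emeasure Q {x \<in> \<Omega>. \<forall>i<N. x i \<in> V' i}"
      using emeasure_distr[OF rm rect_sets[OF V]] by simp
    also have "\<dots> = ennreal (\<nu> {x. \<forall>i<N. x i \<in> V' i})"
      by (rule Q_event) (simp add: V'_def V)
    also have "\<nu> {x. \<forall>i<N. x i \<in> V' i} = measure M {\<omega>\<in>space M. \<forall>i<n. X \<omega> i \<in> V i}"
      unfolding V'_iff by (rule marginal[OF V])
    also have "ennreal \<dots> = emeasure M {\<omega>\<in>space M. \<forall>i<n. X \<omega> i \<in> V i}"
      by (simp add: M.emeasure_eq_measure)
    also have "{\<omega>\<in>space M. \<forall>i<n. X \<omega> i \<in> V i} = X -` Pi\<^sub>E {..<n} V \<inter> space M"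
    proof -
      \<comment> \<open>Values of \<open>X\<close> in the product space are extensional, so
        membership in the rectangle reduces to the coordinate conditions.\<close>
      have "X \<omega> \<in> Pi\<^sub>E {..<n} V \<longleftrightarrow> (\<forall>i<n. X \<omega> i \<in> V i)" if "\<omega> \<in> space M" for \<omega>
        using measurable_space[OF X that] by (simp add: space_PiM PiE_def Pi_def)
      then show ?thesis by blast
    qed
    also have "emeasure M \<dots> = emeasure (distr M (prodS n) X) (Pi\<^sub>E {..<n} V)"
      using emeasure_distr[OF X rect_sets[OF V]] by simp
    finally show "emeasure (distr Q (prodS n) (\<lambda>\<omega>. restrict \<omega> {..<n})) (Pi\<^sub>E {..<n} V) =
        emeasure (distr M (prodS n) X) (Pi\<^sub>E {..<n} V)" .
  qed simp_all
  show ?thesis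
    unfolding extendible_def using n(2) Q_prob exch law by blast
qed

section \<open>The equivalence\<close>

theorem theorem5:
  fixes M :: "'b measure" and X :: "'b \<Rightarrow> nat \<Rightarrow> 'a::t2_space"
    and S0 :: "'a set set" and n N :: nat
  assumes lc: "locally_compact_space (euclidean :: 'a topology)"
    and alg: "algebra UNIV S0"
    and gen: "sigma_sets UNIV S0 = sets (borel :: 'a measure)"
    and P: "prob_space M"
    and n1: "n \<ge> 1"
    and exch: "exchangeable M n X"
    and a: "\<And>\<epsilon>::real. \<epsilon> > 0 \<Longrightarrow> \<exists>V\<in>S0. \<exists>K. compact K \<and> V \<subseteq> K \<and>
              measure M {\<omega>\<in>space M. X \<omega> 0 \<in> V} \<ge> 1 - \<epsilon>"
    and b: "\<And>(\<epsilon>::real) V. \<epsilon> > 0 \<Longrightarrow> V \<in> S0 \<Longrightarrow> \<exists>G W. open G \<and> W \<in> S0 \<and>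
              V \<subseteq> G \<and> G \<subseteq> W \<and> measure M {\<omega>\<in>space M. X \<omega> 0 \<in> W - V} \<le> \<epsilon>"
    and nN: "N > n"
  shows "extendible M n X N \<longleftrightarrow>
    (SUP g\<in>{g\<in>simple_rect_fun S0 n. \<exists>x. U N n g x \<noteq> 0}.
        ereal (\<bar>integral\<^sup>L M (\<lambda>\<omega>. g (X \<omega>))\<bar> / supnorm (U N n g))) = 1"
    (is "_ \<longleftrightarrow> (SUP g\<in>?G. ?ratio g) = 1")
proof -
  interpret M: prob_space M by fact
  interpret S0: algebra UNIV S0 by fact
  have nN': "n \<le> N" using nN by simp
  have X: "X \<in> M \<rightarrow>\<^sub>M prodS n" using exch by (simp add: exchangeable_def)
  have S0: "S0 \<subseteq> sets borel" using gen by auto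
  define e where "e g = (\<integral>\<omega>. g (X \<omega>) \<partial>M)" for g :: "(nat \<Rightarrow> 'a) \<Rightarrow> real"
  have supnorm_pos: "supnorm (U N n g) > 0" if g: "g \<in> ?G" for g
  proof -
    have gs: "g \<in> simple_rect_fun S0 n" using g by blast
    obtain c where c: "\<And>x. \<bar>g x\<bar> \<le> c" using simple_rect_fun_bounded[OF gs] by blast
    have Uc: "\<bar>U N n g x\<bar> \<le> c" for x by (rule abs_U_le[OF nN' c])
    obtain x where x: "U N n g x \<noteq> 0" using g by blast
    then show ?thesis using supnorm_upper[of "U N n g" c, OF Uc, of x] by linarith
  qed
  \<comment> \<open>The constant 1 is admissible with ratio one, so the supremum is never below 1;
    only the upper bound carries information.\<close>
  have one: "(\<lambda>_. 1) \<in> ?G" "?ratio (\<lambda>_. 1) = 1"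
    using const_in_simple_rect_fun[OF S0.top] by (simp_all add: U_const[OF nN'] supnorm_def M.prob_space)
  show ?thesis
  proof
    assume ext: "extendible M n X N"
    show "(SUP g\<in>?G. ?ratio g) = 1"
    proof (rule antisym)
      show "(SUP g\<in>?G. ?ratio g) \<le> 1"
      proof (rule SUP_least)
        fix g assume g: "g \<in> ?G"
        then have "\<bar>integral\<^sup>L M (\<lambda>\<omega>. g (X \<omega>))\<bar> \<le> supnorm (U N n g)"
          using extendible_expectation_bound[OF ext X _ S0] by blast
        then show "?ratio g \<le> 1"
          using supnorm_pos[OF g] by (simp add: field_simps)
      qed
      show "1 \<le> (SUP g\<in>?G. ?ratio g)"
        using SUP_upper[OF one(1), of ?ratio] unfolding one(2) .
    qed
  next
    assume sup: "(SUP g\<in>?G. ?ratio g) = 1"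
    have int: "integrable M (\<lambda>\<omega>. g (X \<omega>))" if g: "g \<in> simple_rect_fun S0 n" for g
    proof -
      obtain c where "\<And>x. \<bar>g x\<bar> \<le> c" using simple_rect_fun_bounded[OF g] by blast
      then show ?thesis
        using measurable_compose[OF X simple_rect_fun_measurable[OF g S0]]
        by (intro M.integrable_const_bound[of _ c]) auto
    qed
    have bound: "e g \<le> (SUP x. U N n g x)" if g: "g \<in> simple_rect_fun S0 n" for g
    proof -
      obtain c where c: "\<And>x. \<bar>g x\<bar> \<le> c" using simple_rect_fun_bounded[OF g] by blast
      have Uc: "\<bar>U N n g x\<bar> \<le> c" for x by (rule abs_U_le[OF nN' c])
      \<comment> \<open>Since \<open>U N n g\<close> is at least \<open>- c\<close>, the shift by
        \<open>c + 1\<close> makes the U-statistic of \<open>h\<close> at least 1. Thus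
        \<open>h\<close> is admissible even when \<open>U N n g\<close> vanishes, and its sup norm
        is a supremum without absolute values. The shift cancels at the end because both
        \<open>e\<close> and \<open>U\<close> preserve constants.\<close>
      define h where "h x = g x + (c + 1)" for x
      have "h \<in> simple_rect_fun S0 n"
        unfolding h_def using simple_rect_fun_add[OF g const_in_simple_rect_fun[OF S0.top]] .
      moreover have Uh: "U N n h x = U N n g x + (c + 1)" for x
        unfolding h_def U_add U_const[OF nN'] ..
      moreover have Uh1: "U N n h x \<ge> 1" for x
        using Uh[of x] Uc[of x] by linarith
      then have "U N n h undefined \<noteq> 0" using not_one_le_zero by metis
      ultimately have h: "h \<in> ?G" by blast
      have "?ratio h \<le> 1" using SUP_upper[OF h, of ?ratio] sup by simp
      then have "\<bar>e h\<bar> \<le> supnorm (U N n h)"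
        using supnorm_pos[OF h] by (simp add: e_def field_simps)
      also have "supnorm (U N n h) \<le> (SUP x. U N n g x) + (c + 1)"
        unfolding supnorm_def
      proof (rule cSUP_least)
        fix x
        have "U N n g x \<le> (SUP x. U N n g x)"
          by (intro cSUP_upper bdd_aboveI2[where M = c] abs_le_D1[OF Uc] UNIV_I)
        then show "\<bar>U N n h x\<bar> \<le> (SUP x. U N n g x) + (c + 1)"
          using Uh[of x] Uh1[of x] by linarith
      qed simp
      also have "e h = e g + (c + 1)"
        using int[OF g] by (simp add: e_def h_def M.prob_space)
      finally show ?thesis by linarith
    qed
    have e_rect: "e (rect_ind n V) = measure M {\<omega>\<in>space M. \<forall>i<n. X \<omega> i \<in> V i}" for V
    proof -
      have "e (rect_ind n V) = (\<integral>\<omega>. indicator {\<omega>. \<forall>i<n. X \<omega> i \<in> V i} \<omega> \<partial>M)"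
        unfolding e_def by (rule Bochner_Integration.integral_cong) (auto simp: rect_ind_eq indicator_def)
      also have "\<dots> = measure M ({\<omega>. \<forall>i<n. X \<omega> i \<in> V i} \<inter> space M)" by simp
      also have "{\<omega>. \<forall>i<n. X \<omega> i \<in> V i} \<inter> space M = {\<omega>\<in>space M. \<forall>i<n. X \<omega> i \<in> V i}" by auto
      finally show ?thesis .
    qed
    have e_add: "e (\<lambda>x. f x + g x) = e f + e g"
      if "f \<in> simple_rect_fun S0 n" "g \<in> simple_rect_fun S0 n" for f g
      using int[OF that(1)] int[OF that(2)] by (simp add: e_def)
    have e_scale: "e (\<lambda>x. c * g x) = c * e g" for c g by (simp add: e_def)
    obtain \<nu> :: "(nat \<Rightarrow> 'a) set \<Rightarrow> real" where \<nu>: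
      "\<And>A. \<nu> A \<ge> 0" "\<And>A B. A \<inter> B = {} \<Longrightarrow> \<nu> (A \<union> B) = \<nu> A + \<nu> B" "\<nu> UNIV = 1"
      "\<And>\<pi> A. \<pi> permutes {..<N} \<Longrightarrow> \<nu> {x. x \<circ> \<pi> \<in> A} = \<nu> A"
      "\<And>V. (\<And>i. i < n \<Longrightarrow> V i \<in> S0) \<Longrightarrow> \<nu> {x. \<forall>i<n. x i \<in> V i} = e (rect_ind n V)"
      using exchangeable_charge[of n N S0 e, OF nN' e_add e_scale bound] by blast
    show "extendible M n X N"
      using charge_imp_extendible[OF alg gen P X n1 nN' a b \<nu>(1-4) \<nu>(5)[unfolded e_rect]] .
  qed
qed

end
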